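(* Let $(X,\mathcal B,\mu,\mathcal T)$ be a finitary factor of an iid system with factor map $\pi$ and coding radius $R$, and let $\{\Gamma_n\}_{n\ge 0}$ be a Følner sequence of finite subsets of $\mathbb Z^d$. Let $v\in C(X)$ with $\mathbb E_\mu[v]=0$, and assume that there exist $p\ge d-1$ and $s>2d+d^2/(p+1)$ such that $v$ is $p$-regular and $\mathbb E[R^s]<\infty$. Then the series $$\sigma_v^2=\sum_{i\in\mathbb Z^d}\mathbb E_\mu[v\,(v\circ T^i)]$$ converges and is non-negative. Moreover, if $\sigma_v^2>0$, then, as $n\to\infty$, $$|\Gamma_n|^{-1/2}\sum_{i\in\Gamma_n}v\circ T^i\longrightarrow_d \mathcal N(0,\sigma_v^2),$$ where $\longrightarrow_d$ denotes convergence in distribution (of random variables on $(X,\mathcal B,\mu)$) and $\mathcal N(0,\sigma_v^2)$ is a centred Gaussian random variable with variance $\sigma_v^2$.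
   Context: Let $A$ be a finite alphabet and $d$ a positive integer. The space $A^{\mathbb Z^d}$ carries the prodiscrete topology and the shift operators $(T^ix)_j=x_{i+j}$, $i,j\in\mathbb Z^d$; $\mathcal T=\{T^i\}_{i\in\mathbb Z^d}$. $X\subseteq A^{\mathbb Z^d}$ is a closed shift-invariant set (subshift), $\mathcal B$ its Borel $\sigma$-algebra, and $\mu$ a $\mathcal T$-invariant probability measure on $(X,\mathcal B)$. $C(X)$ is the space of continuous functions $X\to\mathbb R$, and $\mathbb E_\mu$ is expectation with respect to $\mu$. For $k\ge0$, $B_k=[-k,k]^d\cap\mathbb Z^d$. For bounded $v\colon X\to\mathbb R$, $\delta_k(v)=\sup\{|v(x)-v(x')|: x,x'\in X,\ x|_{B_k}=x'|_{B_k}\}$. For $p\ge0$, $v\in C(X)$ is $p$-regular if $\sum_{k=1}^\infty k^p\delta_k(v)<\infty$. An iid system is a tuple $(\Lambda^{\mathbb Z^d},\mathcal F^{\otimes\mathbb Z^d},\mathbb P^{\mathbb Z^d},\mathcal S)$ where $(\Lambda,\mathcal F,\mathbb P)$ is a standard Borel probability space and $\mathcal S=\{S^i\}_{i\in\mathbb Z^d}$ is the group of shifts, $(S^iy)_j=y_{i+j}$. The system $(X,\mathcal B,\mu,\mathcal T)$ is a finitary factor of an iid system if there exist an iid system and a shift-invariant $G_\delta$ set $Y\subseteq\Lambda^{\mathbb Z^d}$ with $\mathbb P^{\mathbb Z^d}(Y)=1$ such that, with $\mathcal A$ the $\sigma$-algebra induced by $\mathcal F^{\otimes \mathbb Z^d}$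 on $Y$: (I) there is an $\mathcal A$-measurable map $\pi\colon Y\to X$ (factor map) with $\pi_*(\mathbb P^{\mathbb Z^d}|_Y)=\mu$ and $T^i\circ\pi=\pi\circ S^i$ for all $i\in\mathbb Z^d$; (II) there is an $\mathcal A$-measurable function $R\colon Y\to\mathbb Z_{\ge0}$ (coding radius of $\pi$) such that whenever $y,y'\in Y$ satisfy $y|_{B_{R(y)}}=y'|_{B_{R(y)}}$, then $(\pi y)_{\mathbf 0}=(\pi y')_{\mathbf 0}$. $\mathbb E$ without subscript is expectation with respect to $\mathbb P^{\mathbb Z^d}$. A sequence $\{\Gamma_n\}_{n\ge0}$ of finite subsets of $\mathbb Z^d$ is Følner if $\lim_{n\to\infty}|\Gamma_n\cap(\Gamma_n-j)|/|\Gamma_n|=1$ for each $j\in\mathbb Z^d$. *)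

theory Defs
  imports "HOL-Probability.Probability"
begin

text \<open>
  The lattice \<open>\<int>\<^sup>d\<close> is the type \<^typ>\<open>int ^ 'd\<close> with \<open>d = CARD('d)\<close>; configurations over
  an alphabet are functions on it.
\<close>

definition shift_op :: "int ^ 'd \<Rightarrow> (int ^ 'd \<Rightarrow> 'b) \<Rightarrow> (int ^ 'd \<Rightarrow> 'b)" where
  "shift_op i x = (\<lambda>j. x (i + j))"

definition box_set :: "nat \<Rightarrow> (int ^ 'd) set" where
  "box_set k = {j. \<forall>c. - int k \<le> j $ c \<and> j $ c \<le> int k}"

definition agree_on :: "'i set \<Rightarrow> ('i \<Rightarrow> 'b) \<Rightarrow> ('i \<Rightarrow> 'b) \<Rightarrow> bool" where
  "agree_on B x x' \<longleftrightarrow> (\<forall>j\<in>B. x j = x' j)"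

definition borel_sigma :: "'b topology \<Rightarrow> 'b measure" where
  "borel_sigma T = sigma (topspace T) {U. openin T U}"

definition prodiscrete :: "('i \<Rightarrow> 'a) topology" where
  "prodiscrete = product_topology (\<lambda>_. discrete_topology UNIV) UNIV"

definition subshift :: "(int ^ 'd \<Rightarrow> 'a::finite) set \<Rightarrow> bool" where
  "subshift X \<longleftrightarrow> closedin prodiscrete X \<and> (\<forall>i. shift_op i ` X = X)"

definition invariant_prob ::
    "(int ^ 'd \<Rightarrow> 'a::finite) set \<Rightarrow> (int ^ 'd \<Rightarrow> 'a) measure \<Rightarrow> bool" where
  "invariant_prob X \<mu> \<longleftrightarrow>
     space \<mu> = X \<and> sets \<mu> = sets (borel_sigma (subtopology prodiscrete X)) \<and>
     prob_space \<mu> \<and> (\<forall>i. distr \<mu> \<mu> (shift_op i) = \<mu>)"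

text \<open>
  The supremum is taken in \<^typ>\<open>real\<close>, so it has its usual meaning only for nonempty \<open>X\<close> and
  bounded \<open>v\<close>.
\<close>

definition oscillation ::
    "(int ^ 'd \<Rightarrow> 'a) set \<Rightarrow> ((int ^ 'd \<Rightarrow> 'a) \<Rightarrow> real) \<Rightarrow> nat \<Rightarrow> real" where
  "oscillation X v k =
     Sup {\<bar>v x - v x'\<bar> | x x'. x \<in> X \<and> x' \<in> X \<and> agree_on (box_set k) x x'}"

text \<open>The index is shifted by one because the sum starts at \<open>k = 1\<close>.\<close>

definition p_regular ::
    "(int ^ 'd \<Rightarrow> 'a) set \<Rightarrow> real \<Rightarrow> ((int ^ 'd \<Rightarrow> 'a) \<Rightarrow> real) \<Rightarrow> bool" where
  "p_regular X p v \<longleftrightarrow>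
     summable (\<lambda>k. real (Suc k) powr p * oscillation X v (Suc k))"

definition polish_topology_for :: "'l measure \<Rightarrow> 'l topology \<Rightarrow> bool" where
  "polish_topology_for P T \<longleftrightarrow>
     separable_space T \<and> completely_metrizable_space T \<and>
     space P = topspace T \<and> sets P = sets (borel_sigma T)"

definition standard_borel_prob :: "'l measure \<Rightarrow> bool" where
  "standard_borel_prob P \<longleftrightarrow> prob_space P \<and> (\<exists>T. polish_topology_for P T)"

definition iid_measure :: "'l measure \<Rightarrow> (int ^ 'd \<Rightarrow> 'l) measure" where
  "iid_measure P = PiM UNIV (\<lambda>_. P)"

text \<open>
  A standard Borel space carries no canonical topology. That \<open>Y\<close> is a \<open>G\<^sub>\<delta>\<close> set is
  understood with respect to the product topology arising from some Polish topology on the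
  base space that generates its sigma-algebra.
\<close>

definition finitary_factor ::
    "(int ^ 'd \<Rightarrow> 'a::finite) set \<Rightarrow> (int ^ 'd \<Rightarrow> 'a) measure \<Rightarrow>
     'l measure \<Rightarrow> (int ^ 'd \<Rightarrow> 'l) set \<Rightarrow>
     ((int ^ 'd \<Rightarrow> 'l) \<Rightarrow> (int ^ 'd \<Rightarrow> 'a)) \<Rightarrow> ((int ^ 'd \<Rightarrow> 'l) \<Rightarrow> nat) \<Rightarrow> bool" where
  "finitary_factor X \<mu> P Y \<pi> R \<longleftrightarrow>
     standard_borel_prob P \<and>
     (\<exists>T. polish_topology_for P T \<and> gdelta_in (product_topology (\<lambda>_. T) UNIV) Y) \<and>
     (\<forall>i. shift_op i ` Y = Y) \<and>
     emeasure (iid_measure P) Y = 1 \<and>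
     \<pi> \<in> measurable (restrict_space (iid_measure P) Y)
                    (borel_sigma (subtopology prodiscrete X)) \<and>
     distr (restrict_space (iid_measure P) Y) \<mu> \<pi> = \<mu> \<and>
     (\<forall>i. \<forall>y\<in>Y. shift_op i (\<pi> y) = \<pi> (shift_op i y)) \<and>
     R \<in> measurable (restrict_space (iid_measure P) Y) (count_space UNIV) \<and>
     (\<forall>y\<in>Y. \<forall>y'\<in>Y. agree_on (box_set (R y)) y y' \<longrightarrow> \<pi> y 0 = \<pi> y' 0)"

text \<open>
  The quotient is \<open>0\<close> when \<open>\<Gamma> n\<close> is empty, so the limit forces \<open>\<Gamma> n\<close> to be
  nonempty for all large \<open>n\<close>.
\<close>

definition folner :: "(nat \<Rightarrow> (int ^ 'd) set) \<Rightarrow> bool" where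
  "folner \<Gamma> \<longleftrightarrow>
     (\<forall>n. finite (\<Gamma> n)) \<and>
     (\<forall>j. (\<lambda>n. real (card (\<Gamma> n \<inter> (\<lambda>i. i - j) ` \<Gamma> n)) / real (card (\<Gamma> n)))
            \<longlonglongrightarrow> 1)"

definition correlation ::
    "(int ^ 'd \<Rightarrow> 'a) measure \<Rightarrow> ((int ^ 'd \<Rightarrow> 'a) \<Rightarrow> real) \<Rightarrow> int ^ 'd \<Rightarrow> real" where
  "correlation \<mu> v i = (LINT x|\<mu>. v x * v (shift_op i x))"

definition asymptotic_variance ::
    "(int ^ 'd \<Rightarrow> 'a) measure \<Rightarrow> ((int ^ 'd \<Rightarrow> 'a) \<Rightarrow> real) \<Rightarrow> real" where
  "asymptotic_variance \<mu> v = infsum (correlation \<mu> v) UNIV"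

text \<open>The second parameter of the normal density is the standard deviation.\<close>

definition centred_normal :: "real \<Rightarrow> real measure" where
  "centred_normal var = density lborel (\<lambda>x. ennreal (normal_density 0 (sqrt var) x))"

end

theory Submission
  imports Defs
begin

text \<open>
  Let \<open>V = v \<circ> \<pi>\<close> on the iid space, and let \<open>Z\<^sub>k\<close> be the average of \<open>V\<close> over the coordinates
  outside \<open>B\<^sub>2\<^sub>k\<close>. Two points that agree on \<open>B\<^sub>2\<^sub>k\<close> have images that agree on \<open>B\<^sub>k\<close> unless the
  coding radius exceeds \<open>k\<close> at some shift by \<open>j \<in> B\<^sub>k\<close>, so the \<open>L\<^sup>1\<close> distance of \<open>V\<close> and \<open>Z\<^sub>k\<close> is at
  most \<open>\<gamma>\<^sub>k = \<delta>\<^sub>k(v) + C (k + 1)\<^bsup>d - s\<^esup>\<close>, and \<open>\<Sum>\<^sub>k (k + 1)\<^bsup>d - 1\<^esup> \<gamma>\<^sub>k\<close> converges because \<open>p \<ge> d - 1\<close> and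
  \<open>s > 2 d\<close>. Since functions of disjoint sets of coordinates are independent, the autocovariance at
  \<open>i\<close> of the remainder \<open>V - Z\<^sub>k\<close>, and the difference of the autocovariances of \<open>V\<close> and \<open>Z\<^sub>k\<close>, are
  \<open>O(\<gamma>\<^sub>m)\<close> with \<open>m = max k ((|i| - 1) div 4)\<close>. These bounds are summable over \<open>i\<close>, uniformly in \<open>k\<close>,
  and tend to \<open>0\<close>, which reduces everything to the finite-range fields \<open>Z\<^sub>k\<close>.

  For a finite-range field with normalised sums \<open>S\<^sub>n\<close> of variance \<open>v\<^sub>n\<close>, Stein's method in terms of
  the characteristic function \<open>\<phi>\<^sub>n\<close> gives
  \<open>|\<phi>\<^sub>n'(t) + t v\<^sub>n \<phi>\<^sub>n(t)| \<le> \<epsilon>\<^sub>n (|t| + t\<^sup>2)\<close> with \<open>\<epsilon>\<^sub>n = O(|\<Gamma>\<^sub>n|\<^bsup>-1/2\<^esup>)\<close>. Integrating this differential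
  inequality shows \<open>\<phi>\<^sub>n(t) - exp (- v\<^sub>n t\<^sup>2 / 2) \<longlonglongrightarrow> 0\<close>, and the Folner property gives the limit of \<open>v\<^sub>n\<close>.
\<close>

section \<open>Independence in iid fields\<close>

text \<open>For independent samples \<open>y\<close> and \<open>z\<close>, this is \<open>y\<close>
  with the coordinates outside \<open>A\<close> resampled.\<close>

definition glue :: "'i set \<Rightarrow> ('i \<Rightarrow> 'b) \<Rightarrow> ('i \<Rightarrow> 'b) \<Rightarrow> 'i \<Rightarrow> 'b" where
  "glue A y z = (\<lambda>j. if j \<in> A then y j else z j)"

text \<open>A pointwise form of measurability with respect to the coordinates in \<open>A\<close>;
  it leaves no null sets to track.\<close>

definition depends_on :: "'i set \<Rightarrow> (('i \<Rightarrow> 'b) \<Rightarrow> 'c) \<Rightarrow> bool" where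
  "depends_on A f \<longleftrightarrow> (\<forall>y y'. agree_on A y y' \<longrightarrow> f y = f y')"

lemma depends_onD: "depends_on A f \<Longrightarrow> agree_on A y y' \<Longrightarrow> f y = f y'"
  by (auto simp: depends_on_def)

lemma depends_on_mono: "depends_on A f \<Longrightarrow> A \<subseteq> B \<Longrightarrow> depends_on B f"
  unfolding depends_on_def agree_on_def by blast

lemma depends_on_comp: "depends_on A f \<Longrightarrow> depends_on A (\<lambda>y. h (f y))"
  unfolding depends_on_def by metis

lemma depends_on_comp2:
  "depends_on A f \<Longrightarrow> depends_on A g \<Longrightarrow> depends_on A (\<lambda>y. h (f y) (g y))"
  unfolding depends_on_def by metis

lemma depends_on_sum:
  "(\<And>i. i \<in> I \<Longrightarrow> depends_on A (f i)) \<Longrightarrow> depends_on A (\<lambda>y. \<Sum>i\<in>I. f i y)"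
  unfolding depends_on_def by (auto intro!: sum.cong)

lemma agree_on_glue: "agree_on A (glue A y z) y" "A \<inter> B = {} \<Longrightarrow> agree_on B (glue A y z) z"
  by (auto simp: agree_on_def glue_def)

lemma depends_on_glue:
  assumes "depends_on A f"
  shows "f (glue A y z) = f y"
  using depends_onD[OF assms agree_on_glue(1)] .

lemma depends_on_glue_disjoint:
  assumes "depends_on B f" "A \<inter> B = {}"
  shows "f (glue A y z) = f z"
  using depends_onD[OF assms(1) agree_on_glue(2)[OF assms(2)]] .

lemma measurable_glue:
  "(\<lambda>(y, z). glue A y z) \<in> PiM UNIV (\<lambda>_. P) \<Otimes>\<^sub>M PiM UNIV (\<lambda>_. P) \<rightarrow>\<^sub>M PiM UNIV (\<lambda>_. P)"
  unfolding glue_def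
proof (rule measurable_PiM_single')
  show "(\<lambda>x. (case x of (y, z) \<Rightarrow> \<lambda>j. if j \<in> A then y j else z j) i)
      \<in> PiM UNIV (\<lambda>_. P) \<Otimes>\<^sub>M PiM UNIV (\<lambda>_. P) \<rightarrow>\<^sub>M P" for i
    by (cases "i \<in> A") (auto simp: case_prod_beta')
qed (auto simp: space_pair_measure space_PiM PiE_iff split: prod.splits)

text \<open>
  Independence of disjoint sets of coordinates is used only in this form: resampling the coordinates
  outside \<open>A\<close> does not change the law, and expectations of products then factor by Fubini.
\<close>

lemma distr_glue:
  fixes P :: "'l measure" and A :: "'i set"
  assumes P: "prob_space P"
  defines "M \<equiv> PiM UNIV (\<lambda>_::'i. P)"
  shows "distr (M \<Otimes>\<^sub>M M) M (\<lambda>(y, z). glue A y z) = M"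
proof -
  interpret P: prob_space P by fact
  interpret M: prob_space M unfolding M_def by (intro prob_space_PiM P)
  have g: "(\<lambda>(y, z). glue A y z) \<in> M \<Otimes>\<^sub>M M \<rightarrow>\<^sub>M M"
    unfolding M_def by (rule measurable_glue)
  \<comment> \<open>A finite measure on the product space is determined by its values on finite
    cylinders.\<close>
  have "M = distr (M \<Otimes>\<^sub>M M) M (\<lambda>(y, z). glue A y z)"
  proof (rule measure_eqI_PiM_infinite[where I = UNIV and M = "\<lambda>_. P"])
    show "sets M = sets (PiM UNIV (\<lambda>_. P))" by (simp add: M_def)
    show "sets (distr (M \<Otimes>\<^sub>M M) M (\<lambda>(y, z). glue A y z)) = sets (PiM UNIV (\<lambda>_. P))"
      by (simp add: M_def)
    show "finite_measure M" by unfold_locales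
    fix E :: "'i \<Rightarrow> 'l set" and J :: "'i set"
    assume J: "finite J" and E: "\<And>i. i \<in> J \<Longrightarrow> E i \<in> sets P"
    let ?emb = "\<lambda>J. prod_emb UNIV (\<lambda>_. P) J (Pi\<^sub>E J E)"
    have emb: "emeasure M (?emb J') = (\<Prod>i\<in>J'. emeasure P (E i))" if "J' \<subseteq> J" for J'
      unfolding M_def using that E J P by (intro emeasure_PiM_emb) (auto intro: finite_subset)
    have sets: "?emb J' \<in> sets M" if "J' \<subseteq> J" for J'
      unfolding M_def using that E J by (intro sets_PiM_I) (auto intro: finite_subset)
    \<comment> \<open>The coordinates in \<open>J\<close> split into those read from
      \<open>y\<close> and those read from \<open>z\<close>, so the cylinder pulls back to a
      rectangle.\<close>
    have "emeasure M (?emb J) = (\<Prod>i\<in>J \<inter> A. emeasure P (E i)) * (\<Prod>i\<in>J - A. emeasure P (E i))"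
      using J by (simp add: emb prod.Int_Diff[of J _ A])
    also have "\<dots> = emeasure M (?emb (J \<inter> A)) * emeasure M (?emb (J - A))"
      by (simp add: emb)
    also have "\<dots> = emeasure (M \<Otimes>\<^sub>M M) (?emb (J \<inter> A) \<times> ?emb (J - A))"
      by (intro M.emeasure_pair_measure_Times[symmetric] sets) auto
    also have "?emb (J \<inter> A) \<times> ?emb (J - A) =
        (\<lambda>(y, z). glue A y z) -` ?emb J \<inter> space (M \<Otimes>\<^sub>M M)"
      by (auto simp: prod_emb_def space_pair_measure M_def space_PiM PiE_iff glue_def split: if_splits)
    also have "emeasure (M \<Otimes>\<^sub>M M) \<dots> = emeasure (distr (M \<Otimes>\<^sub>M M) M (\<lambda>(y, z). glue A y z)) (?emb J)"
      by (intro emeasure_distr[symmetric] g sets) auto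
    finally show "emeasure M (?emb J) = emeasure (distr (M \<Otimes>\<^sub>M M) M (\<lambda>(y, z). glue A y z)) (?emb J)" .
  qed
  then show ?thesis ..
qed

section \<open>Stationarity, independence and averaging in the iid field\<close>

locale iid_field =
  fixes P :: "'l measure" and M :: "(int ^ 'd \<Rightarrow> 'l) measure"
  assumes prob_P: "prob_space P" and M_eq: "M = iid_measure P"
begin

sublocale prob_space M
  unfolding M_eq iid_measure_def by (intro prob_space_PiM prob_P)

sublocale MM: pair_prob_space M M ..

lemma measurable_glue_M [measurable]: "(\<lambda>(y, z). glue A y z) \<in> M \<Otimes>\<^sub>M M \<rightarrow>\<^sub>M M"
  unfolding M_eq iid_measure_def by (rule measurable_glue)

lemma distr_glue_M: "distr (M \<Otimes>\<^sub>M M) M (\<lambda>(y, z). glue A y z) = M"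
  unfolding M_eq iid_measure_def by (rule distr_glue[OF prob_P])

lemma distr_fst_M: "distr (M \<Otimes>\<^sub>M M) M fst = M"
proof -
  have "(\<lambda>(y, z). glue UNIV y z) = (fst :: (int ^ 'd \<Rightarrow> 'l) \<times> _ \<Rightarrow> _)"
    by (auto simp: glue_def fun_eq_iff)
  then show ?thesis using distr_glue_M[of UNIV] by simp
qed

lemma measurable_shift [measurable]: "shift_op i \<in> M \<rightarrow>\<^sub>M M"
  unfolding M_eq iid_measure_def shift_op_def
  by (rule measurable_PiM_single') (auto simp: space_PiM)

lemma distr_shift: "distr M M (shift_op i) = M"
  using distr_PiM_reindex[of "UNIV :: (int ^ 'd) set" "\<lambda>_. P" "\<lambda>j. i + j" UNIV] prob_P
  by (simp add: M_eq iid_measure_def shift_op_def[abs_def] restrict_UNIV)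

lemma integral_shift:
  fixes f :: "_ \<Rightarrow> 'b::{banach, second_countable_topology}"
  assumes "f \<in> borel_measurable M"
  shows "(\<integral>y. f (shift_op i y) \<partial>M) = (\<integral>y. f y \<partial>M)"
  using integral_distr[OF measurable_shift assms, of i] by (simp add: distr_shift)

lemma integrable_bounded:
  fixes f :: "_ \<Rightarrow> 'b::{banach, second_countable_topology}"
  assumes "f \<in> borel_measurable M" "\<And>y. norm (f y) \<le> K"
  shows "integrable M f"
  using assms by (intro integrable_const_bound[of _ K]) auto

text \<open>After the coordinates outside \<open>A\<close> are resampled, \<open>f\<close> reads
  only the first sample and \<open>g\<close> only the second. The value type is a general field
  because real covariances and complex exponentials are both factored in this way.\<close>

lemma integral_mult_disjoint:
  fixes f g :: "_ \<Rightarrow> 'b::{real_normed_field, banach, second_countable_topology}"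
  assumes [measurable]: "f \<in> borel_measurable M" "g \<in> borel_measurable M"
    and bd: "\<And>y. norm (f y) \<le> K" "\<And>y. norm (g y) \<le> L"
    and dep: "depends_on A f" "depends_on B g" "A \<inter> B = {}"
  shows "(\<integral>y. f y * g y \<partial>M) = (\<integral>y. f y \<partial>M) * (\<integral>y. g y \<partial>M)"
proof -
  have KL: "norm (f y * g z) \<le> K * L" for y z
    unfolding norm_mult using bd[of y] bd[of z] by (intro mult_mono) (auto intro: order_trans[OF norm_ge_zero])
  have int: "integrable (M \<Otimes>\<^sub>M M) (\<lambda>(y, z). f y * g z)"
    using KL by (intro MM.integrable_const_bound[of _ "K * L"]) auto
  have "(\<integral>y. f y * g y \<partial>M) = (\<integral>y. f y * g y \<partial>distr (M \<Otimes>\<^sub>M M) M (\<lambda>(y, z). glue A y z))"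
    by (simp add: distr_glue_M)
  also have "\<dots> = (\<integral>(y, z). f (glue A y z) * g (glue A y z) \<partial>(M \<Otimes>\<^sub>M M))"
    by (subst integral_distr) (auto simp: case_prod_beta')
  also have "\<dots> = (\<integral>(y, z). f y * g z \<partial>(M \<Otimes>\<^sub>M M))"
    by (simp add: depends_on_glue[OF dep(1)] depends_on_glue_disjoint[OF dep(2,3)])
  also have "\<dots> = (\<integral>y. \<integral>z. f y * g z \<partial>M \<partial>M)"
    using MM.integral_fst'[OF int] by simp
  also have "\<dots> = (\<integral>y. f y \<partial>M) * (\<integral>y. g y \<partial>M)"
    by simp
  finally show ?thesis .
qed

text \<open>A version of the conditional expectation of \<open>f\<close> given the coordinates in
  \<open>A\<close>, defined at every point.\<close>

definition avg :: "(int ^ 'd) set \<Rightarrow> ((int ^ 'd \<Rightarrow> 'l) \<Rightarrow> real) \<Rightarrow> (int ^ 'd \<Rightarrow> 'l) \<Rightarrow> real" where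
  "avg A f y = (\<integral>z. f (glue A y z) \<partial>M)"

lemma depends_on_avg: "depends_on A (avg A f)"
proof -
  have "glue A y = glue A y'" if "agree_on A y y'" for y y' :: "int ^ 'd \<Rightarrow> 'l"
    using that by (auto simp: glue_def agree_on_def fun_eq_iff)
  then show ?thesis by (auto simp: depends_on_def avg_def)
qed

context
  fixes f :: "(int ^ 'd \<Rightarrow> 'l) \<Rightarrow> real" and K :: real
  assumes f [measurable]: "f \<in> borel_measurable M" and bd: "\<And>y. \<bar>f y\<bar> \<le> K"
begin

lemma avg_measurable [measurable]: "avg A f \<in> borel_measurable M"
  unfolding avg_def by measurable

lemma measurable_glue_snd [measurable]: "y \<in> space M \<Longrightarrow> glue A y \<in> M \<rightarrow>\<^sub>M M"
  using measurable_compose_Pair1[OF _ measurable_glue_M] by (simp add: eta_contract_eq)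

lemma avg_bound: "\<bar>avg A f y\<bar> \<le> K"
proof -
  have K: "K \<ge> 0" using bd order_trans abs_ge_zero by blast
  have "\<bar>avg A f y\<bar> \<le> (\<integral>z. \<bar>f (glue A y z)\<bar> \<partial>M)"
    unfolding avg_def by (rule integral_abs_bound)
  also have "\<dots> \<le> (\<integral>z. K \<partial>M)"
    using bd K by (intro integral_mono') auto
  finally show ?thesis by (simp add: prob_space)
qed

lemma integrable_glue: "integrable (M \<Otimes>\<^sub>M M) (\<lambda>(y, z). f (glue A y z))"
proof (rule MM.integrable_const_bound[of _ K])
  show "AE x in M \<Otimes>\<^sub>M M. norm (case x of (y, z) \<Rightarrow> f (glue A y z)) \<le> K"
    using bd by (auto simp: split_beta)
qed measurable

lemma integral_avg: "(\<integral>y. avg A f y \<partial>M) = (\<integral>y. f y \<partial>M)"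
proof -
  have "(\<integral>y. avg A f y \<partial>M) = (\<integral>(y, z). f (glue A y z) \<partial>(M \<Otimes>\<^sub>M M))"
    using MM.integral_fst'[OF integrable_glue[of A]] by (simp add: avg_def)
  also have "\<dots> = (\<integral>y. f y \<partial>distr (M \<Otimes>\<^sub>M M) M (\<lambda>(y, z). glue A y z))"
    by (subst integral_distr) (auto simp: case_prod_beta')
  finally show ?thesis by (simp add: distr_glue_M)
qed

text \<open>The triangle inequality for the inner integral. The right-hand side compares
  \<open>f\<close> at two points that agree on \<open>A\<close>, which is the situation that a
  coding radius controls.\<close>

lemma integral_diff_avg_le:
  "(\<integral>y. \<bar>f y - avg A f y\<bar> \<partial>M) \<le> (\<integral>(y, z). \<bar>f y - f (glue A y z)\<bar> \<partial>(M \<Otimes>\<^sub>M M))"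
proof -
  have int: "integrable (M \<Otimes>\<^sub>M M) (\<lambda>(y, z). f y - f (glue A y z))"
  proof (rule MM.integrable_const_bound[of _ "2 * K"])
    have "\<bar>f y - f z\<bar> \<le> 2 * K" for y z using bd[of y] bd[of z] by linarith
    then show "AE x in M \<Otimes>\<^sub>M M. norm (case x of (y, z) \<Rightarrow> f y - f (glue A y z)) \<le> 2 * K"
      by (auto simp: split_beta)
  qed measurable
  have int': "integrable (M \<Otimes>\<^sub>M M) (\<lambda>(y, z). \<bar>f y - f (glue A y z)\<bar>)"
  proof -
    have eq: "(\<lambda>(y, z). \<bar>f y - f (glue A y z)\<bar>) = (\<lambda>x. \<bar>case x of (y, z) \<Rightarrow> f y - f (glue A y z)\<bar>)"
      by (rule ext) (simp add: split_beta)
    show ?thesis unfolding eq by (rule integrable_abs[OF int])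
  qed
  have "(\<integral>y. \<bar>f y - avg A f y\<bar> \<partial>M) \<le> (\<integral>y. \<integral>z. \<bar>f y - f (glue A y z)\<bar> \<partial>M \<partial>M)"
  proof (rule integral_mono_AE)
    show "integrable M (\<lambda>y. \<bar>f y - avg A f y\<bar>)"
      using bd avg_bound by (intro integrable_abs Bochner_Integration.integrable_diff integrable_bounded[of _ K]) auto
    show "integrable M (\<lambda>y. \<integral>z. \<bar>f y - f (glue A y z)\<bar> \<partial>M)"
      using MM.integrable_fst'[OF int'] by simp
    show "AE y in M. \<bar>f y - avg A f y\<bar> \<le> (\<integral>z. \<bar>f y - f (glue A y z)\<bar> \<partial>M)"
    proof (rule AE_I2)
      fix y assume [measurable]: "y \<in> space M"
      have "integrable M (\<lambda>z. f (glue A y z))"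
        using bd by (intro integrable_bounded[of _ K]) auto
      then have "f y - avg A f y = (\<integral>z. f y - f (glue A y z) \<partial>M)"
        by (simp add: avg_def prob_space)
      then show "\<bar>f y - avg A f y\<bar> \<le> (\<integral>z. \<bar>f y - f (glue A y z)\<bar> \<partial>M)"
        by (simp add: integral_abs_bound)
    qed
  qed
  also have "\<dots> = (\<integral>(y, z). \<bar>f y - f (glue A y z)\<bar> \<partial>(M \<Otimes>\<^sub>M M))"
    using MM.integral_fst'[OF int'] by simp
  finally show ?thesis .
qed

end

end

section \<open>Stein's method for characteristic functions\<close>

text \<open>The integrating factor is \<open>exp (v * s\<^sup>2 / 2)\<close>. It increases with |s|,
  so on the interval it is largest at the end point, and that value cancels on dividing back; the
  final bound is therefore free of \<open>v\<close>.\<close>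

lemma gaussian_ode_bound:
  fixes \<phi> \<phi>' :: "real \<Rightarrow> complex"
  assumes der: "\<And>t. (\<phi> has_vector_derivative \<phi>' t) (at t)"
    and one: "\<phi> 0 = 1" and nonneg: "v \<ge> 0" "a \<ge> 0" "b \<ge> 0"
    and bd: "\<And>t. norm (\<phi>' t + of_real (t * v) * \<phi> t) \<le> \<bar>t\<bar> * a + t\<^sup>2 * b"
  shows "norm (\<phi> t - of_real (exp (- v * t\<^sup>2 / 2))) \<le> t\<^sup>2 * a + \<bar>t\<bar> ^ 3 * b"
proof -
  define e where "e s = exp (v * s\<^sup>2 / 2)" for s :: real
  define B where "B = (\<bar>t\<bar> * a + t\<^sup>2 * b) * e t"
  have der_e: "(e has_real_derivative v * s * e s) (at s)" for s
    unfolding e_def by (auto intro!: derivative_eq_intros simp: power2_eq_square)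
  define \<psi>' where "\<psi>' s = e s *\<^sub>R (\<phi>' s + of_real (s * v) * \<phi> s)" for s
  have der_\<psi>: "((\<lambda>s. e s *\<^sub>R \<phi> s) has_vector_derivative \<psi>' s) (at s)" for s
  proof -
    have "((\<lambda>s. e s *\<^sub>R \<phi> s) has_vector_derivative e s *\<^sub>R \<phi>' s + (v * s * e s) *\<^sub>R \<phi> s) (at s)"
      by (rule has_vector_derivative_scaleR[OF der_e der])
    also have "e s *\<^sub>R \<phi>' s + (v * s * e s) *\<^sub>R \<phi> s = \<psi>' s"
      by (simp add: \<psi>'_def scaleR_conv_of_real algebra_simps)
    finally show ?thesis .
  qed
  \<comment> \<open>The mean value inequality between 0 and \<open>t\<close>; the symmetric interval
    serves both signs of \<open>t\<close>.\<close>
  have "norm (e t *\<^sub>R \<phi> t - e 0 *\<^sub>R \<phi> 0) \<le> B * norm (t - 0)"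
  proof (rule differentiable_bound[where S = "{-\<bar>t\<bar>..\<bar>t\<bar>}" and f' = "\<lambda>s h. h *\<^sub>R \<psi>' s"])
    fix s assume s: "s \<in> {-\<bar>t\<bar>..\<bar>t\<bar>}"
    show "((\<lambda>s. e s *\<^sub>R \<phi> s) has_derivative (\<lambda>h. h *\<^sub>R \<psi>' s)) (at s within {-\<bar>t\<bar>..\<bar>t\<bar>})"
      using der_\<psi>[of s] by (auto simp: has_vector_derivative_def intro: has_derivative_at_withinI)
    have st: "\<bar>s\<bar> \<le> \<bar>t\<bar>" using s by auto
    have s2: "s\<^sup>2 \<le> t\<^sup>2" using st by (simp add: abs_le_square_iff)
    have "norm (\<psi>' s) = e s * norm (\<phi>' s + of_real (s * v) * \<phi> s)"
      by (simp add: \<psi>'_def e_def)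
    also have "\<dots> \<le> e t * (\<bar>t\<bar> * a + t\<^sup>2 * b)"
    proof (rule mult_mono)
      show "e s \<le> e t" unfolding e_def using s2 nonneg by (simp add: mult_left_mono)
      show "norm (\<phi>' s + of_real (s * v) * \<phi> s) \<le> \<bar>t\<bar> * a + t\<^sup>2 * b"
        by (rule order_trans[OF bd]) (use st s2 nonneg in \<open>auto intro!: add_mono mult_right_mono\<close>)
    qed (auto simp: e_def)
    finally show "onorm (\<lambda>h. h *\<^sub>R \<psi>' s) \<le> B"
      by (simp add: onorm_scaleR_left[OF bounded_linear_ident] onorm_id[unfolded id_def] B_def mult.commute)
  qed auto
  then have 1: "norm (e t *\<^sub>R \<phi> t - 1) \<le> B * \<bar>t\<bar>" by (simp add: e_def one)
  have et: "e t > 0" by (simp add: e_def)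
  have "\<phi> t - of_real (exp (- v * t\<^sup>2 / 2)) = inverse (e t) *\<^sub>R (e t *\<^sub>R \<phi> t - 1)"
    using et by (simp add: e_def scaleR_conv_of_real algebra_simps exp_minus)
  then have "norm (\<phi> t - of_real (exp (- v * t\<^sup>2 / 2))) = inverse (e t) * norm (e t *\<^sub>R \<phi> t - 1)"
    using et by simp
  also have "\<dots> \<le> inverse (e t) * (B * \<bar>t\<bar>)"
    using 1 et by (intro mult_left_mono) auto
  also have "\<dots> = t\<^sup>2 * a + \<bar>t\<bar> ^ 3 * b"
    using et by (simp add: B_def power2_eq_square power3_eq_cube algebra_simps abs_mult_self_eq)
  finally show ?thesis .
qed

lemma iexp_quadratic_bound: "cmod (iexp x - 1 - \<i> * x) \<le> x\<^sup>2 / 2"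
  using iexp_approx1[of x 1] by (simp add: diff_diff_eq power2_eq_square)

section \<open>Moment bounds and the Stein inequality for locally dependent sums\<close>

context prob_space
begin

text \<open>The variance of |Z| is nonnegative.\<close>

lemma expectation_abs_le_sqrt:
  fixes Z :: "'a \<Rightarrow> real"
  assumes [measurable]: "Z \<in> borel_measurable M" and bd: "\<And>\<omega>. \<bar>Z \<omega>\<bar> \<le> L"
  shows "expectation (\<lambda>\<omega>. \<bar>Z \<omega>\<bar>) \<le> sqrt (expectation (\<lambda>\<omega>. (Z \<omega>)\<^sup>2))"
proof -
  have i1: "integrable M (\<lambda>\<omega>. \<bar>Z \<omega>\<bar>)"
    using bd by (intro integrable_const_bound[of _ L]) auto
  have i2: "integrable M (\<lambda>\<omega>. \<bar>Z \<omega>\<bar>\<^sup>2)"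
    using power_mono[OF bd abs_ge_zero, of _ 2] by (intro integrable_const_bound[of _ "L\<^sup>2"]) auto
  have "0 \<le> variance (\<lambda>\<omega>. \<bar>Z \<omega>\<bar>)" by (rule variance_positive)
  also have "\<dots> = expectation (\<lambda>\<omega>. \<bar>Z \<omega>\<bar>\<^sup>2) - (expectation (\<lambda>\<omega>. \<bar>Z \<omega>\<bar>))\<^sup>2"
    by (rule variance_eq[OF i1 i2])
  finally show ?thesis by (intro real_le_rsqrt) simp
qed

text \<open>For bounded \<open>S\<close> the remainder of the first-order expansion is at most
  \<open>L\<^sup>2 / 2 * h\<^sup>2\<close> at every sample point, which justifies differentiating
  under the integral.\<close>

lemma char_has_vector_derivative:
  fixes S :: "'a \<Rightarrow> real"
  assumes [measurable]: "S \<in> borel_measurable M" and bd: "\<And>\<omega>. \<bar>S \<omega>\<bar> \<le> L"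
  shows "((\<lambda>t. CLINT \<omega>|M. iexp (t * S \<omega>)) has_vector_derivative
    (CLINT \<omega>|M. \<i> * S \<omega> * iexp (t * S \<omega>))) (at t)"
  unfolding has_vector_derivative_def
proof (rule has_derivativeI_sandwich[where e = 1 and H = "\<lambda>u. L\<^sup>2 / 2 * \<bar>u - t\<bar>"])
  show "bounded_linear (\<lambda>x. x *\<^sub>R (CLINT \<omega>|M. \<i> * S \<omega> * iexp (t * S \<omega>)))"
    by (rule bounded_linear_scaleR_left)
  show "((\<lambda>u. L\<^sup>2 / 2 * \<bar>u - t\<bar>) \<longlongrightarrow> 0) (at t)"
    by (auto intro!: tendsto_eq_intros)
  fix u :: real assume ut: "u \<noteq> t"
  define h where "h = u - t"
  have int1: "integrable M (\<lambda>\<omega>. iexp (x * S \<omega>))" for x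
    by (intro integrable_const_bound[of _ 1]) auto
  have int2: "integrable M (\<lambda>\<omega>. \<i> * S \<omega> * iexp (t * S \<omega>))"
    using bd by (intro integrable_const_bound[of _ L]) (auto simp: norm_mult)
  have "(CLINT \<omega>|M. iexp (u * S \<omega>)) - (CLINT \<omega>|M. iexp (t * S \<omega>))
      - h *\<^sub>R (CLINT \<omega>|M. \<i> * S \<omega> * iexp (t * S \<omega>))
      = (CLINT \<omega>|M. iexp (u * S \<omega>) - iexp (t * S \<omega>) - h *\<^sub>R (\<i> * S \<omega> * iexp (t * S \<omega>)))"
    using int1 int2 by simp
  also have "norm \<dots> \<le> (\<integral>\<omega>. L\<^sup>2 / 2 * h\<^sup>2 \<partial>M)"
  proof (rule order_trans[OF integral_norm_bound], rule integral_mono')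
    fix \<omega>
    have "iexp (u * S \<omega>) - iexp (t * S \<omega>) - h *\<^sub>R (\<i> * S \<omega> * iexp (t * S \<omega>))
      = iexp (t * S \<omega>) * (iexp (h * S \<omega>) - 1 - \<i> * (h * S \<omega>))"
      by (simp add: h_def scaleR_conv_of_real algebra_simps flip: exp_add)
    then have "cmod (iexp (u * S \<omega>) - iexp (t * S \<omega>) - h *\<^sub>R (\<i> * S \<omega> * iexp (t * S \<omega>)))
      = cmod (iexp (h * S \<omega>) - 1 - \<i> * (h * S \<omega>))"
      by (simp add: norm_mult)
    also have "\<dots> \<le> (h * S \<omega>)\<^sup>2 / 2"
      using iexp_quadratic_bound[of "h * S \<omega>"] by simp
    also have "\<dots> \<le> L\<^sup>2 / 2 * h\<^sup>2"
      using power_mono[OF bd[of \<omega>] abs_ge_zero, of 2] mult_right_mono[of "(S \<omega>)\<^sup>2" "L\<^sup>2" "h\<^sup>2"]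
      by (simp add: power_mult_distrib mult.commute)
    finally show "norm (iexp (u * S \<omega>) - iexp (t * S \<omega>) - h *\<^sub>R (\<i> * S \<omega> * iexp (t * S \<omega>)))
      \<le> L\<^sup>2 / 2 * h\<^sup>2" .
  qed auto
  finally show "norm ((CLINT \<omega>|M. iexp (u * S \<omega>)) - (CLINT \<omega>|M. iexp (t * S \<omega>))
      - (u - t) *\<^sub>R (CLINT \<omega>|M. \<i> * S \<omega> * iexp (t * S \<omega>))) / norm (u - t) \<le> L\<^sup>2 / 2 * \<bar>u - t\<bar>"
    using ut by (simp add: h_def prob_space divide_simps power2_eq_square abs_mult_self_eq)
qed auto

text \<open>After expanding the square only pairs with \<open>j\<close> in \<open>N i\<close>
  survive, at most \<open>card G * D\<close> of them; the bound is linear in \<open>card G\<close>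
  instead of quadratic.\<close>

lemma second_moment_local:
  fixes Z :: "'i \<Rightarrow> 'a \<Rightarrow> real" and L :: real and D :: nat
  assumes G: "finite G" and [measurable]: "\<And>i. i \<in> G \<Longrightarrow> Z i \<in> borel_measurable M"
    and bd: "\<And>i \<omega>. i \<in> G \<Longrightarrow> \<bar>Z i \<omega>\<bar> \<le> L"
    and far: "\<And>i j. i \<in> G \<Longrightarrow> j \<in> G \<Longrightarrow> j \<notin> N i \<Longrightarrow> expectation (\<lambda>\<omega>. Z i \<omega> * Z j \<omega>) = 0"
    and card: "\<And>i. i \<in> G \<Longrightarrow> card (G \<inter> N i) \<le> D"
  shows "expectation (\<lambda>\<omega>. (\<Sum>i\<in>G. Z i \<omega>)\<^sup>2) \<le> card G * (D * L\<^sup>2)"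
proof -
  have bd2: "\<bar>Z i \<omega> * Z j \<omega>\<bar> \<le> L\<^sup>2" if "i \<in> G" "j \<in> G" for i j \<omega>
    unfolding abs_mult power2_eq_square using bd[OF that(1), of \<omega>] bd[OF that(2), of \<omega>]
    by (intro mult_mono) (auto intro: order_trans[OF abs_ge_zero])
  have int: "integrable M (\<lambda>\<omega>. Z i \<omega> * Z j \<omega>)" if "i \<in> G" "j \<in> G" for i j
    using that bd2[OF that] by (intro integrable_const_bound[of _ "L\<^sup>2"]) auto
  have e: "expectation (\<lambda>\<omega>. Z i \<omega> * Z j \<omega>) \<le> L\<^sup>2" if "i \<in> G" "j \<in> G" for i j
  proof -
    have "expectation (\<lambda>\<omega>. Z i \<omega> * Z j \<omega>) \<le> expectation (\<lambda>\<omega>. L\<^sup>2)"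
      using abs_le_D1[OF bd2[OF that]] int[OF that] by (intro integral_mono) auto
    then show ?thesis by (simp add: prob_space)
  qed
  have "expectation (\<lambda>\<omega>. (\<Sum>i\<in>G. Z i \<omega>)\<^sup>2) = (\<Sum>i\<in>G. \<Sum>j\<in>G. expectation (\<lambda>\<omega>. Z i \<omega> * Z j \<omega>))"
    by (simp add: power2_eq_square sum_product int)
  also have "\<dots> = (\<Sum>i\<in>G. \<Sum>j\<in>G \<inter> N i. expectation (\<lambda>\<omega>. Z i \<omega> * Z j \<omega>))"
    using far G by (intro sum.cong sum.mono_neutral_right) auto
  also have "\<dots> \<le> (\<Sum>i\<in>G. D * L\<^sup>2)"
  proof (rule sum_mono)
    fix i assume i: "i \<in> G"
    have "(\<Sum>j\<in>G \<inter> N i. expectation (\<lambda>\<omega>. Z i \<omega> * Z j \<omega>)) \<le> card (G \<inter> N i) * L\<^sup>2"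
      using sum_bounded_above[of "G \<inter> N i" _ "L\<^sup>2"] e[OF i] by auto
    also have "\<dots> \<le> D * L\<^sup>2" using card[OF i] by (intro mult_right_mono) auto
    finally show "(\<Sum>j\<in>G \<inter> N i. expectation (\<lambda>\<omega>. Z i \<omega> * Z j \<omega>)) \<le> D * L\<^sup>2" .
  qed
  finally show ?thesis by simp
qed

text \<open>
  Stein's identity: in \<open>E[X\<^sub>i exp(i t S)]\<close> the factor \<open>exp(i t S)\<close> may be reduced by the exponential of the
  part of \<open>S\<close> outside \<open>N i\<close>, which is independent of \<open>X\<^sub>i\<close>; a first-order expansion of the difference
  leaves the quadratic form \<open>Q\<close>, which is close to its mean \<open>q\<close>.
\<close>

lemma stein_bound:
  fixes X :: "'i \<Rightarrow> 'a \<Rightarrow> real" and c K \<epsilon> t :: real and D :: nat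
  assumes G: "finite G" and meas [measurable]: "\<And>i. i \<in> G \<Longrightarrow> X i \<in> borel_measurable M"
    and bd: "\<And>i \<omega>. \<bar>X i \<omega>\<bar> \<le> K" and c: "c \<ge> 0"
    and card: "\<And>i. i \<in> G \<Longrightarrow> card (G \<inter> N i) \<le> D"
    and far: "\<And>i. i \<in> G \<Longrightarrow> (CLINT \<omega>|M. X i \<omega> * iexp (t * (c * (\<Sum>j\<in>G - N i. X j \<omega>)))) = 0"
  defines "S \<equiv> \<lambda>\<omega>. c * (\<Sum>i\<in>G. X i \<omega>)"
    and "Q \<equiv> \<lambda>\<omega>. c\<^sup>2 * (\<Sum>i\<in>G. \<Sum>j\<in>G \<inter> N i. X i \<omega> * X j \<omega>)"
  assumes Q: "expectation (\<lambda>\<omega>. \<bar>Q \<omega> - q\<bar>) \<le> \<epsilon>"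
  shows "cmod ((CLINT \<omega>|M. \<i> * S \<omega> * iexp (t * S \<omega>)) + (t * q) * (CLINT \<omega>|M. iexp (t * S \<omega>)))
    \<le> \<bar>t\<bar> * \<epsilon> + t\<^sup>2 * (card G * (c ^ 3 * D\<^sup>2 * K ^ 3))"
proof -
  have K: "K \<ge> 0" using bd[of undefined undefined] by linarith
  have S [measurable]: "S \<in> borel_measurable M" unfolding S_def by measurable
  have Qm [measurable]: "Q \<in> borel_measurable M" unfolding Q_def by measurable
  \<comment> \<open>The part of \<open>S\<close> inside \<open>N i\<close>; what remains of
    \<open>S\<close> is the sum that appears in \<open>far\<close>.\<close>
  define \<Delta> where "\<Delta> i \<omega> = c * (\<Sum>j\<in>G \<inter> N i. X j \<omega>)" for i \<omega>
  have \<Delta>m [measurable]: "\<Delta> i \<in> borel_measurable M" for i unfolding \<Delta>_def by measurable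
  have split: "S \<omega> = c * (\<Sum>j\<in>G - N i. X j \<omega>) + \<Delta> i \<omega>" for i \<omega>
    unfolding S_def \<Delta>_def using sum.Int_Diff[OF G, of "\<lambda>j. X j \<omega>" "N i"] by (simp add: algebra_simps)
  have \<Delta>_bd: "\<bar>\<Delta> i \<omega>\<bar> \<le> c * (D * K)" if "i \<in> G" for i \<omega>
  proof -
    have "\<bar>\<Sum>j\<in>G \<inter> N i. X j \<omega>\<bar> \<le> (\<Sum>j\<in>G \<inter> N i. K)"
      using bd by (intro order_trans[OF sum_abs] sum_mono) auto
    also have "\<dots> \<le> D * K" using card[OF that] K by (simp add: mult_right_mono)
    finally show ?thesis using c by (simp add: \<Delta>_def abs_mult mult_left_mono)
  qed
  have X_int: "integrable M (\<lambda>\<omega>. X i \<omega> * iexp (f \<omega>))" if "i \<in> G" "f \<in> borel_measurable M" for i f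
    using that bd by (intro integrable_const_bound[of _ K]) (auto simp: norm_mult)
  have X\<Delta>_int: "integrable M (\<lambda>\<omega>. X i \<omega> * \<Delta> i \<omega> * iexp (t * S \<omega>))" if "i \<in> G" for i
  proof (intro integrable_const_bound[of _ "K * (c * (D * K))"])
    show "AE \<omega> in M. norm (X i \<omega> * \<Delta> i \<omega> * iexp (t * S \<omega>)) \<le> K * (c * (D * K))"
      using bd \<Delta>_bd[OF that] K by (auto simp: norm_mult intro!: mult_mono)
  qed (use that in measurable)
  \<comment> \<open>The error in replacing the expectation of \<open>X i * iexp (t * S)\<close> by
    its first-order term in \<open>\<Delta> i\<close>.\<close>
  define err where "err i = (CLINT \<omega>|M. X i \<omega> * iexp (t * S \<omega>)) - \<i> * t * (CLINT \<omega>|M. X i \<omega> * \<Delta> i \<omega> * iexp (t * S \<omega>))" for i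
  have err: "cmod (err i) \<le> K * ((t * (c * (D * K)))\<^sup>2 / 2)" if i: "i \<in> G" for i
  proof -
    \<comment> \<open>The integral inserted here is 0 by \<open>far\<close>.\<close>
    have "err i = (CLINT \<omega>|M. X i \<omega> * iexp (t * S \<omega>)) - (CLINT \<omega>|M. X i \<omega> * iexp (t * (c * (\<Sum>j\<in>G - N i. X j \<omega>))))
       - \<i> * t * (CLINT \<omega>|M. X i \<omega> * \<Delta> i \<omega> * iexp (t * S \<omega>))"
      unfolding err_def far[OF i] by simp
    also have "\<dots> = (CLINT \<omega>|M. X i \<omega> * iexp (t * S \<omega>) - X i \<omega> * iexp (t * (c * (\<Sum>j\<in>G - N i. X j \<omega>)))
       - \<i> * t * (X i \<omega> * \<Delta> i \<omega> * iexp (t * S \<omega>)))" (is "_ = ?R")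
      using X_int[OF i, of "\<lambda>\<omega>. t * S \<omega>"] X_int[OF i, of "\<lambda>\<omega>. t * (c * (\<Sum>j\<in>G - N i. X j \<omega>))"] X\<Delta>_int[OF i]
      by simp
    finally have err_eq: "err i = ?R" .
    have "cmod ?R \<le> (\<integral>\<omega>. K * ((t * (c * (D * K)))\<^sup>2 / 2) \<partial>M)"
    proof (rule order_trans[OF integral_norm_bound], rule integral_mono')
      fix \<omega>
      \<comment> \<open>The expansion is made around \<open>S\<close>, not around its independent
        part, hence the minus sign.\<close>
      let ?x = "- (t * \<Delta> i \<omega>)"
      have "iexp (t * (c * (\<Sum>j\<in>G - N i. X j \<omega>))) = iexp (t * S \<omega>) * iexp ?x"
        by (simp add: split[of \<omega> i] algebra_simps flip: exp_add)
      then have "X i \<omega> * iexp (t * S \<omega>) - X i \<omega> * iexp (t * (c * (\<Sum>j\<in>G - N i. X j \<omega>)))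
         - \<i> * t * (X i \<omega> * \<Delta> i \<omega> * iexp (t * S \<omega>))
         = - (X i \<omega> * iexp (t * S \<omega>) * (iexp ?x - 1 - \<i> * ?x))"
        by (simp add: algebra_simps)
      then have "cmod (X i \<omega> * iexp (t * S \<omega>) - X i \<omega> * iexp (t * (c * (\<Sum>j\<in>G - N i. X j \<omega>)))
         - \<i> * t * (X i \<omega> * \<Delta> i \<omega> * iexp (t * S \<omega>)))
         = \<bar>X i \<omega>\<bar> * cmod (iexp ?x - 1 - \<i> * ?x)"
        by (simp only: norm_minus_cancel norm_mult norm_exp_i_times norm_of_real mult_1_right)
      also have "\<dots> \<le> K * (?x\<^sup>2 / 2)"
        using bd K iexp_quadratic_bound[of ?x] by (intro mult_mono) (simp_all only: abs_ge_zero norm_ge_zero)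
      also have "\<dots> \<le> K * ((t * (c * (D * K)))\<^sup>2 / 2)"
        using \<Delta>_bd[OF i, of \<omega>] K power_mono[OF \<Delta>_bd[OF i, of \<omega>] abs_ge_zero, of 2]
        by (intro mult_left_mono divide_right_mono) (auto simp: power_mult_distrib intro!: mult_left_mono)
      finally show "norm (X i \<omega> * iexp (t * S \<omega>) - X i \<omega> * iexp (t * (c * (\<Sum>j\<in>G - N i. X j \<omega>)))
         - \<i> * t * (X i \<omega> * \<Delta> i \<omega> * iexp (t * S \<omega>))) \<le> K * ((t * (c * (D * K)))\<^sup>2 / 2)" .
    qed (use K in auto)
    then show ?thesis unfolding err_eq by (simp add: prob_space)
  qed
  have Q_eq: "Q \<omega> = c * (\<Sum>i\<in>G. X i \<omega> * \<Delta> i \<omega>)" for \<omega>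
    by (simp add: Q_def \<Delta>_def power2_eq_square sum_distrib_left mult_ac)
  have Q_bd: "\<bar>Q \<omega>\<bar> \<le> c * (card G * (K * (c * (D * K))))" for \<omega>
  proof -
    have "\<bar>\<Sum>i\<in>G. X i \<omega> * \<Delta> i \<omega>\<bar> \<le> (\<Sum>i\<in>G. K * (c * (D * K)))"
      using bd K \<Delta>_bd by (intro order_trans[OF sum_abs] sum_mono) (auto simp: abs_mult intro!: mult_mono)
    then show ?thesis using c by (simp add: Q_eq abs_mult mult_left_mono)
  qed
  have Qe_int: "integrable M (\<lambda>\<omega>. Q \<omega> * iexp (t * S \<omega>))"
    using Q_bd by (intro integrable_const_bound[of _ "c * (card G * (K * (c * (D * K))))"]) (auto simp: norm_mult)
  have e_int: "integrable M (\<lambda>\<omega>. iexp (t * S \<omega>))"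
    by (intro integrable_const_bound[of _ 1]) auto
  \<comment> \<open>Summing over \<open>i\<close> recovers \<open>S\<close> on the left, and the
    first-order terms add up to \<open>- t\<close> times the expectation of
    \<open>Q * iexp (t * S)\<close>.\<close>
  have "(CLINT \<omega>|M. \<i> * S \<omega> * iexp (t * S \<omega>)) = \<i> * c * (\<Sum>i\<in>G. CLINT \<omega>|M. X i \<omega> * iexp (t * S \<omega>))"
  proof -
    have "(\<lambda>\<omega>. \<i> * S \<omega> * iexp (t * S \<omega>)) = (\<lambda>\<omega>. \<i> * c * (\<Sum>i\<in>G. X i \<omega> * iexp (t * S \<omega>)))"
      by (simp add: S_def sum_distrib_left sum_distrib_right mult_ac)
    then show ?thesis using X_int[of _ "\<lambda>\<omega>. t * S \<omega>"] by simp
  qed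
  also have "\<dots> = \<i> * c * (\<Sum>i\<in>G. err i) - t * (c * (\<Sum>i\<in>G. CLINT \<omega>|M. X i \<omega> * \<Delta> i \<omega> * iexp (t * S \<omega>)))"
    unfolding err_def sum_subtractf sum_distrib_left[symmetric] by (simp add: algebra_simps)
  also have "complex_of_real c * (\<Sum>i\<in>G. CLINT \<omega>|M. X i \<omega> * \<Delta> i \<omega> * iexp (t * S \<omega>)) = (CLINT \<omega>|M. Q \<omega> * iexp (t * S \<omega>))"
    using X\<Delta>_int by (simp add: Q_eq sum_distrib_right mult.assoc)
  finally have 1: "(CLINT \<omega>|M. \<i> * S \<omega> * iexp (t * S \<omega>)) = \<i> * c * (\<Sum>i\<in>G. err i) - t * (CLINT \<omega>|M. Q \<omega> * iexp (t * S \<omega>))" .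
  have 2: "(CLINT \<omega>|M. (Q \<omega> - q) * iexp (t * S \<omega>))
      = (CLINT \<omega>|M. Q \<omega> * iexp (t * S \<omega>)) - q * (CLINT \<omega>|M. iexp (t * S \<omega>))"
    using Qe_int e_int by (simp add: left_diff_distrib)
  \<comment> \<open>Adding the term with \<open>q\<close> turns \<open>Q\<close> into
    \<open>Q - q\<close>, which is small in mean.\<close>
  have "(CLINT \<omega>|M. \<i> * S \<omega> * iexp (t * S \<omega>)) + (t * q) * (CLINT \<omega>|M. iexp (t * S \<omega>))
      = \<i> * c * (\<Sum>i\<in>G. err i) - t * (CLINT \<omega>|M. (Q \<omega> - q) * iexp (t * S \<omega>))"
    unfolding 1 2 by (simp add: algebra_simps)
  then have "cmod ((CLINT \<omega>|M. \<i> * S \<omega> * iexp (t * S \<omega>)) + (t * q) * (CLINT \<omega>|M. iexp (t * S \<omega>)))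
      = cmod (\<i> * c * (\<Sum>i\<in>G. err i) - t * (CLINT \<omega>|M. (Q \<omega> - q) * iexp (t * S \<omega>)))"
    by (rule arg_cong)
  also have "\<dots> \<le> c * (card G * (K * ((t * (c * (D * K)))\<^sup>2 / 2))) + \<bar>t\<bar> * \<epsilon>"
  proof (rule order_trans[OF norm_triangle_ineq4], rule add_mono)
    have "cmod (\<Sum>i\<in>G. err i) \<le> card G * (K * ((t * (c * (D * K)))\<^sup>2 / 2))"
      by (rule order_trans[OF norm_sum sum_bounded_above]) (rule err)
    then have "c * cmod (\<Sum>i\<in>G. err i) \<le> c * (card G * (K * ((t * (c * (D * K)))\<^sup>2 / 2)))"
      using c by (rule mult_left_mono)
    then show "cmod (\<i> * c * (\<Sum>i\<in>G. err i)) \<le> c * (card G * (K * ((t * (c * (D * K)))\<^sup>2 / 2)))"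
      using c by (simp add: norm_mult)
    have "cmod (CLINT \<omega>|M. (Q \<omega> - q) * iexp (t * S \<omega>)) \<le> expectation (\<lambda>\<omega>. \<bar>Q \<omega> - q\<bar>)"
      using integral_norm_bound[of M "\<lambda>\<omega>. (Q \<omega> - q) * iexp (t * S \<omega>)"]
      by (simp add: norm_mult flip: of_real_diff)
    then show "cmod (t * (CLINT \<omega>|M. (Q \<omega> - q) * iexp (t * S \<omega>))) \<le> \<bar>t\<bar> * \<epsilon>"
      using Q by (simp add: norm_mult mult_left_mono)
  qed
  also have "c * (card G * (K * ((t * (c * (D * K)))\<^sup>2 / 2))) \<le> t\<^sup>2 * (card G * (c ^ 3 * D\<^sup>2 * K ^ 3))"
  proof -
    have "0 \<le> t\<^sup>2 * (card G * (c ^ 3 * D\<^sup>2 * K ^ 3))" using c K by simp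
    moreover have "c * (card G * (K * ((t * (c * (D * K)))\<^sup>2 / 2))) = (t\<^sup>2 * (card G * (c ^ 3 * D\<^sup>2 * K ^ 3))) / 2"
      by (simp add: power2_eq_square power3_eq_cube mult_ac)
    ultimately show ?thesis by linarith
  qed
  finally show ?thesis by simp
qed

end

section \<open>Finite-range fields\<close>

lemma box_set_iff: "j \<in> box_set k \<longleftrightarrow> (\<forall>c. \<bar>j $ c\<bar> \<le> int k)"
  unfolding box_set_def by (simp add: abs_le_iff) (metis minus_le_iff)

lemma box_set_diff: "i \<in> box_set k \<Longrightarrow> j \<in> box_set l \<Longrightarrow> i - j \<in> box_set (k + l)"
  unfolding box_set_iff by (metis abs_triangle_ineq4 add_mono of_nat_add order_trans vector_minus_component)

lemma box_set_add: "i \<in> box_set k \<Longrightarrow> j \<in> box_set l \<Longrightarrow> i + j \<in> box_set (k + l)"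
  unfolding box_set_iff by (metis abs_triangle_ineq add_mono of_nat_add order_trans vector_add_component)

lemma box_set_mono: "k \<le> l \<Longrightarrow> box_set k \<subseteq> box_set l"
  unfolding box_set_iff subset_iff by (meson of_nat_le_iff order_trans)

lemma box_set_0: "box_set 0 = {0}"
  by (auto simp: box_set_iff vec_eq_iff)

lemma
  finite_box_set: "finite (box_set k :: (int ^ 'd) set)" and
  card_box_set: "card (box_set k :: (int ^ 'd) set) = (2 * k + 1) ^ CARD('d)"
proof -
  have eq: "box_set k = vec_lambda ` (\<Pi>\<^sub>E c\<in>(UNIV :: 'd set). {- int k..int k})"
  proof (rule set_eqI)
    fix j :: "int ^ 'd"
    show "j \<in> box_set k \<longleftrightarrow> j \<in> vec_lambda ` (\<Pi>\<^sub>E c\<in>(UNIV :: 'd set). {- int k..int k})"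
      by (auto simp: box_set_def PiE_iff image_iff intro!: bexI[of _ "vec_nth j"])
  qed
  have inj: "inj_on vec_lambda (\<Pi>\<^sub>E c\<in>(UNIV :: 'd set). {- int k..int k})"
    by (auto simp: inj_on_def vec_lambda_inject)
  show "finite (box_set k :: (int ^ 'd) set)"
    unfolding eq by (intro finite_imageI finite_PiE) auto
  show "card (box_set k :: (int ^ 'd) set) = (2 * k + 1) ^ CARD('d)"
    unfolding eq card_image[OF inj] by (simp add: card_PiE nat_add_distrib nat_mult_distrib)
qed

definition nbhd :: "nat \<Rightarrow> int ^ 'd \<Rightarrow> (int ^ 'd) set" where
  "nbhd k i = (+) i ` box_set k"

lemma nbhd_iff: "j \<in> nbhd k i \<longleftrightarrow> j - i \<in> box_set k"
  unfolding nbhd_def by (metis (no_types, lifting) add_diff_cancel_left' diff_add_cancel add.commute image_iff)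

lemma card_nbhd: "card (nbhd k i :: (int ^ 'd) set) = (2 * k + 1) ^ CARD('d)"
  unfolding nbhd_def by (simp add: card_image card_box_set)

lemma finite_nbhd: "finite (nbhd k i :: (int ^ 'd) set)"
  unfolding nbhd_def by (simp add: finite_box_set)

lemma card_Int_nbhd_le: "card (G \<inter> nbhd k (i :: int ^ 'd)) \<le> (2 * k + 1) ^ CARD('d)"
  using card_mono[OF finite_nbhd, of "G \<inter> nbhd k i" k i] by (simp add: card_nbhd)

lemma nbhd_disjoint: "j \<notin> nbhd (k + l) i \<Longrightarrow> nbhd k i \<inter> nbhd l j = {}"
proof (rule ccontr)
  assume j: "j \<notin> nbhd (k + l) i" and "nbhd k i \<inter> nbhd l j \<noteq> {}"
  then obtain x where "x - i \<in> box_set k" "x - j \<in> box_set l" by (auto simp: nbhd_iff)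
  from box_set_diff[OF this] j show False by (simp add: nbhd_iff)
qed

lemma nbhd_trans: "j \<in> nbhd k i \<Longrightarrow> nbhd l j \<subseteq> nbhd (k + l) i"
  using box_set_add[of "j - i" k _ l] by (fastforce simp: nbhd_iff)

lemma shift_op_shift_op: "shift_op i (shift_op j y) = shift_op (i + j) y"
  by (auto simp: shift_op_def add.assoc add.left_commute intro!: ext)

lemma shift_op_0: "shift_op 0 y = y"
  by (simp add: shift_op_def)

lemma depends_on_shift:
  assumes "depends_on (box_set r) f"
  shows "depends_on (nbhd r i) (\<lambda>y. f (shift_op i y))"
  unfolding depends_on_def
  by (auto intro!: depends_onD[OF assms] simp: agree_on_def shift_op_def nbhd_def)

text \<open>Pairs are grouped by their difference \<open>l\<close>. The number of pairs with a given
  difference is exactly the cardinality in the Folner condition, and \<open>L\<close> may be any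
  finite set off which \<open>h\<close> vanishes.\<close>

lemma sum_differences:
  fixes h :: "'g::ab_group_add \<Rightarrow> real"
  assumes "finite G" "finite L" "\<And>l. l \<notin> L \<Longrightarrow> h l = 0"
  shows "(\<Sum>i\<in>G. \<Sum>j\<in>G. h (j - i)) = (\<Sum>l\<in>L. card (G \<inter> (\<lambda>i. i - l) ` G) * h l)"
proof -
  have "(\<Sum>j\<in>G. h (j - i)) = (\<Sum>l\<in>L. indicator {l. i + l \<in> G} l * h l)" for i
  proof -
    have "(\<Sum>j\<in>G. h (j - i)) = (\<Sum>l\<in>{l. i + l \<in> G}. h l)"
      by (rule sum.reindex_bij_witness[of _ "\<lambda>l. i + l" "\<lambda>j. j - i"]) auto
    also have "\<dots> = (\<Sum>l\<in>L \<inter> {l. i + l \<in> G}. h l)"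
    proof (rule sum.mono_neutral_right)
      have "{l. i + l \<in> G} \<subseteq> (\<lambda>j. j - i) ` G" by (auto simp: image_iff intro!: bexI[of _ "i + _"])
      then show "finite {l. i + l \<in> G}" using assms(1) by (meson finite_imageI finite_subset)
    qed (use assms in auto)
    also have "\<dots> = (\<Sum>l\<in>L. indicator {l. i + l \<in> G} l * h l)"
      using assms by (simp add: indicator_def if_distrib[of "\<lambda>x. x * _"] sum.inter_filter[symmetric] Int_def cong: if_cong)
    finally show ?thesis .
  qed
  then have "(\<Sum>i\<in>G. \<Sum>j\<in>G. h (j - i)) = (\<Sum>l\<in>L. \<Sum>i\<in>G. indicator {l. i + l \<in> G} l * h l)"
    by (simp add: sum.swap[of _ G L])
  also have "\<dots> = (\<Sum>l\<in>L. card (G \<inter> (\<lambda>i. i - l) ` G) * h l)"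
  proof (rule sum.cong[OF refl])
    fix l
    have "G \<inter> (\<lambda>i. i - l) ` G = {i \<in> G. i + l \<in> G}"
      by (auto simp: image_iff intro!: bexI[of _ "_ + l"])
    moreover have "(\<Sum>i\<in>G. indicator {l. i + l \<in> G} l * h l) = (\<Sum>i\<in>{i \<in> G. i + l \<in> G}. h l)"
      using assms(1) by (simp add: Int_def indicator_def if_distrib[of "\<lambda>x. x * _"] sum.inter_filter cong: if_cong)
    ultimately show "(\<Sum>i\<in>G. indicator {l. i + l \<in> G} l * h l) = card (G \<inter> (\<lambda>i. i - l) ` G) * h l"
      by simp
  qed
  finally show ?thesis .
qed

text \<open>Intersecting a nonempty finite set with its translate by the all-ones vector loses at
  least one point, so the Folner quotient is at most \<open>1 - 1 / card (\<Gamma> n)\<close>; its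
  limit 1 forces the cardinalities to infinity.\<close>

lemma folner_card:
  fixes \<Gamma> :: "nat \<Rightarrow> (int ^ 'd) set"
  assumes "folner \<Gamma>"
  shows "(\<lambda>n. 1 / real (card (\<Gamma> n))) \<longlonglongrightarrow> 0"
proof -
  define e :: "int ^ 'd" where "e = (\<chi> c. 1)"
  let ?q = "\<lambda>n. real (card (\<Gamma> n \<inter> (\<lambda>i. i - e) ` \<Gamma> n)) / real (card (\<Gamma> n))"
  have lim: "?q \<longlonglongrightarrow> 1" and fin: "\<And>n. finite (\<Gamma> n)" using assms unfolding folner_def by auto
  have lt: "card (\<Gamma> n \<inter> (\<lambda>i. i - e) ` \<Gamma> n) < card (\<Gamma> n)" if "\<Gamma> n \<noteq> {}" for n
  proof (rule psubset_card_mono[OF fin])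
    \<comment> \<open>Any coordinate will do because every entry of \<open>e\<close> is 1: a point
      of \<open>\<Gamma> n\<close> whose coordinate \<open>c\<close> is maximal is not in the
      translate.\<close>
    define c :: 'd where "c = undefined"
    define m where "m = Max ((\<lambda>i. i $ c) ` \<Gamma> n)"
    have "m \<in> (\<lambda>i. i $ c) ` \<Gamma> n" unfolding m_def using that fin by (intro Max_in) auto
    then obtain i where i: "i \<in> \<Gamma> n" "i $ c = m" by auto
    have "i \<notin> (\<lambda>i. i - e) ` \<Gamma> n"
    proof
      assume "i \<in> (\<lambda>i. i - e) ` \<Gamma> n"
      then obtain k where k: "k \<in> \<Gamma> n" "i = k - e" by auto
      then have "k $ c \<le> m" unfolding m_def using fin by (intro Max_ge) auto
      then show False using i(2) k(2) by (simp add: e_def)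
    qed
    then show "\<Gamma> n \<inter> (\<lambda>i. i - e) ` \<Gamma> n \<subset> \<Gamma> n" using i(1) by auto
  qed
  \<comment> \<open>For empty \<open>\<Gamma> n\<close> both divisions by zero give 0 and the claim
    reads 0 \<le> 1.\<close>
  have le: "1 / real (card (\<Gamma> n)) \<le> 1 - ?q n" for n
  proof (cases "\<Gamma> n = {}")
    case False
    then have "card (\<Gamma> n) > 0" using fin by (simp add: card_gt_0_iff)
    then show ?thesis using lt[OF False] by (simp add: field_simps)
  qed auto
  have lim0: "(\<lambda>n. 1 - ?q n) \<longlonglongrightarrow> 0" using tendsto_diff[OF tendsto_const lim, of 1] by simp
  show ?thesis
  proof (rule tendsto_sandwich[OF _ _ tendsto_const lim0])
    show "\<forall>\<^sub>F n in sequentially. 1 / real (card (\<Gamma> n)) \<le> 1 - ?q n"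
      by (rule always_eventually[OF allI[OF le]])
  qed simp
qed

section \<open>Autocovariances and the central limit theorem for finite-range fields\<close>

context iid_field
begin

definition autocov :: "((int ^ 'd \<Rightarrow> 'l) \<Rightarrow> real) \<Rightarrow> int ^ 'd \<Rightarrow> real" where
  "autocov f i = (\<integral>y. f y * f (shift_op i y) \<partial>M)"

lemma integrable_mult_bounded:
  fixes f g :: "(int ^ 'd \<Rightarrow> 'l) \<Rightarrow> real"
  assumes "f \<in> borel_measurable M" "g \<in> borel_measurable M"
    "\<And>y. \<bar>f y\<bar> \<le> K" "\<And>y. \<bar>g y\<bar> \<le> L"
  shows "integrable M (\<lambda>y. f y * g y)"
proof (rule integrable_bounded[of _ "K * L"])
  show "norm (f y * g y) \<le> K * L" for y
    using assms(3)[of y] assms(4)[of y] by (auto simp: abs_mult intro!: mult_mono)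
qed (use assms in measurable)

lemma autocov_shift:
  assumes [measurable]: "f \<in> borel_measurable M"
  shows "(\<integral>y. f (shift_op i y) * f (shift_op j y) \<partial>M) = autocov f (j - i)"
  using integral_shift[of "\<lambda>y. f y * f (shift_op (j - i) y)" i]
  by (simp add: autocov_def shift_op_shift_op)

lemma second_moment_sum:
  assumes [measurable]: "f \<in> borel_measurable M" and bd: "\<And>y. \<bar>f y\<bar> \<le> K"
  shows "(\<integral>y. (c * (\<Sum>i\<in>G. f (shift_op i y)))\<^sup>2 \<partial>M) = c\<^sup>2 * (\<Sum>i\<in>G. \<Sum>j\<in>G. autocov f (j - i))"
proof -
  have "integrable M (\<lambda>y. f (shift_op i y) * f (shift_op j y))" for i j
    using bd by (intro integrable_mult_bounded[of _ _ K K]) auto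
  then show ?thesis
    by (simp add: power_mult_distrib power2_eq_square[of "sum _ _"] sum_product autocov_shift)
qed

context
  fixes U :: "(int ^ 'd \<Rightarrow> 'l) \<Rightarrow> real" and r :: nat and K :: real
  assumes U [measurable]: "U \<in> borel_measurable M" and bd: "\<And>y. \<bar>U y\<bar> \<le> K"
    and dep: "depends_on (box_set r) U" and mean: "(\<integral>y. U y \<partial>M) = 0"
begin

text \<open>\<open>U\<close> reads \<open>nbhd r 0\<close> and its translate reads
  \<open>nbhd r i\<close>; beyond distance \<open>2 * r\<close> these are disjoint, and the
  expectation factors into means equal to 0.\<close>

lemma autocov_eq_0: "i \<notin> box_set (2 * r) \<Longrightarrow> autocov U i = 0"
proof -
  assume i: "i \<notin> box_set (2 * r)"
  have "autocov U i = (\<integral>y. U y \<partial>M) * (\<integral>y. U (shift_op i y) \<partial>M)"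
    unfolding autocov_def
  proof (rule integral_mult_disjoint[of _ _ K K])
    show "depends_on (nbhd r 0) U" using dep by (simp add: nbhd_def)
    show "depends_on (nbhd r i) (\<lambda>y. U (shift_op i y))" by (rule depends_on_shift[OF dep])
    show "nbhd r 0 \<inter> nbhd r i = {}" using i by (intro nbhd_disjoint) (simp add: nbhd_iff mult_2)
  qed (use bd in auto)
  then show ?thesis by (simp add: mean)
qed

text \<open>\<open>stein_bound\<close> with neighbourhoods of radius \<open>2 * r\<close> and with
  the variance of \<open>S\<close> as \<open>q\<close>, followed by
  \<open>gaussian_ode_bound\<close>. \<open>D\<close> and \<open>D'\<close> count the points within
  distance \<open>2 * r\<close> and \<open>6 * r\<close>. For \<open>c\<close> the inverse square
  root of \<open>card G\<close> the right-hand side is a fixed multiple of \<open>c\<close>.\<close>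

lemma finite_range_char_bound:
  fixes c t :: real
  assumes G: "finite G" and c: "c \<ge> 0" "c\<^sup>2 * card G \<le> 1"
  defines "S \<equiv> \<lambda>y. c * (\<Sum>i\<in>G. U (shift_op i y))"
    and "D \<equiv> real ((4 * r + 1) ^ CARD('d))" and "D' \<equiv> real ((12 * r + 1) ^ CARD('d))"
  shows "cmod ((CLINT y|M. iexp (t * S y)) - exp (- (\<integral>y. (S y)\<^sup>2 \<partial>M) * t\<^sup>2 / 2))
    \<le> c * (t\<^sup>2 * (2 * D * K\<^sup>2 * sqrt D') + \<bar>t\<bar> ^ 3 * (D\<^sup>2 * K ^ 3))"
proof -
  define X where "X i y = U (shift_op i y)" for i y
  define N :: "int ^ 'd \<Rightarrow> (int ^ 'd) set" where "N = nbhd (2 * r)"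
  define v where "v = (\<integral>y. (S y)\<^sup>2 \<partial>M)"
  define q where "q i y = (\<Sum>j\<in>G \<inter> N i. X i y * X j y)" for i y
  define Q where "Q y = c\<^sup>2 * (\<Sum>i\<in>G. \<Sum>j\<in>G \<inter> N i. X i y * X j y)" for y
  define \<epsilon> where "\<epsilon> = c * (2 * D * K\<^sup>2 * sqrt D')"
  have K: "K \<ge> 0" using bd[of undefined] by linarith
  have X [measurable]: "X i \<in> borel_measurable M" for i unfolding X_def by measurable
  have Xbd: "\<bar>X i y\<bar> \<le> K" for i y by (simp add: X_def bd)
  have Xdep: "depends_on (nbhd r i) (X i)" for i
    unfolding X_def[abs_def] by (rule depends_on_shift[OF dep])
  have Xmean: "(\<integral>y. X i y \<partial>M) = 0" for i
    unfolding X_def using integral_shift[OF U] mean by simp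
  have S_eq: "S = (\<lambda>y. c * (\<Sum>i\<in>G. X i y))" by (simp add: S_def X_def)
  have [measurable]: "S \<in> borel_measurable M" unfolding S_eq by measurable
  have qm [measurable]: "q i \<in> borel_measurable M" for i unfolding q_def by measurable
  have Dge: "D \<ge> 0" "D' \<ge> 0" by (auto simp: D_def D'_def)
  have cardN: "card (G \<inter> N i) \<le> (4 * r + 1) ^ CARD('d)" for i
    using card_Int_nbhd_le[of G "2 * r" i] by (simp add: N_def)
  have qbd: "\<bar>q i y\<bar> \<le> D * K\<^sup>2" for i y
  proof -
    have "\<bar>q i y\<bar> \<le> (\<Sum>j\<in>G \<inter> N i. K\<^sup>2)"
      unfolding q_def using Xbd K
      by (intro order_trans[OF sum_abs] sum_mono) (auto simp: abs_mult power2_eq_square intro!: mult_mono)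
    also have "\<dots> \<le> D * K\<^sup>2"
      using of_nat_mono[OF cardN[of i], where ?'a = real] by (simp add: D_def mult_right_mono del: of_nat_power)
    finally show ?thesis .
  qed
  have qdep: "depends_on (nbhd (3 * r) i) (q i)" for i
    unfolding q_def
  proof (rule depends_on_sum, rule depends_on_comp2[where h = "(*)"])
    fix j assume "j \<in> G \<inter> N i"
    then have "nbhd r j \<subseteq> nbhd (2 * r + r) i" by (intro nbhd_trans) (auto simp: N_def)
    then show "depends_on (nbhd (3 * r) i) (X j)" by (intro depends_on_mono[OF Xdep]) simp
    show "depends_on (nbhd (3 * r) i) (X i)"
      by (rule depends_on_mono[OF Xdep]) (simp add: nbhd_def image_mono box_set_mono)
  qed
  \<comment> \<open>The centred contribution of \<open>i\<close> to the quadratic form. It reads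
    only \<open>nbhd (3 * r) i\<close>, so two contributions are uncorrelated beyond distance
    \<open>6 * r\<close>.\<close>
  define Z where "Z i y = c\<^sup>2 * (q i y - (\<integral>y. q i y \<partial>M))" for i y
  have q_int: "integrable M (q i)" for i using qbd by (intro integrable_bounded[of _ "D * K\<^sup>2"]) auto
  have Eqbd: "\<bar>\<integral>y. q i y \<partial>M\<bar> \<le> D * K\<^sup>2" for i
  proof -
    have "\<bar>\<integral>y. q i y \<partial>M\<bar> \<le> (\<integral>y. \<bar>q i y\<bar> \<partial>M)" by (rule integral_abs_bound)
    also have "\<dots> \<le> (\<integral>y. D * K\<^sup>2 \<partial>M)" using qbd q_int by (intro integral_mono) auto
    finally show ?thesis by (simp add: prob_space)
  qed
  have Zbd: "\<bar>Z i y\<bar> \<le> c\<^sup>2 * (2 * D * K\<^sup>2)" for i y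
    unfolding Z_def abs_mult using qbd[of i y] Eqbd[of i]
    by (intro mult_mono) (auto intro: order_trans[OF abs_triangle_ineq4])
  have [measurable]: "Z i \<in> borel_measurable M" for i unfolding Z_def by measurable
  have Zdep: "depends_on (nbhd (3 * r) i) (Z i)" for i
    unfolding Z_def[abs_def] by (rule depends_on_comp[OF qdep])
  have Zmean: "(\<integral>y. Z i y \<partial>M) = 0" for i
    unfolding Z_def using q_int[of i] by (simp add: prob_space)
  have ZZ: "(\<integral>y. Z i y * Z k y \<partial>M) = 0" if "k \<notin> nbhd (6 * r) i" for i k
  proof -
    have "(\<integral>y. Z i y * Z k y \<partial>M) = (\<integral>y. Z i y \<partial>M) * (\<integral>y. Z k y \<partial>M)"
    proof (rule integral_mult_disjoint[OF _ _ _ _ Zdep Zdep])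
      show "nbhd (3 * r) i \<inter> nbhd (3 * r) k = {}" using that by (intro nbhd_disjoint) simp
    qed (use Zbd in auto)
    then show ?thesis by (simp add: Zmean)
  qed
  \<comment> \<open>At most \<open>card G * D'\<close> pairs of size of order \<open>c ^ 4\<close>
    remain; with \<open>c\<^sup>2 * card G \<le> 1\<close> this is of order
    \<open>c\<^sup>2\<close>, so its root is of order \<open>c\<close>.\<close>
  have "(\<integral>y. (\<Sum>i\<in>G. Z i y)\<^sup>2 \<partial>M) \<le> card G * (real ((12 * r + 1) ^ CARD('d)) * (c\<^sup>2 * (2 * D * K\<^sup>2))\<^sup>2)"
    using ZZ Zbd card_Int_nbhd_le[of G "6 * r"] by (intro second_moment_local[OF G, where N = "nbhd (6 * r)"]) auto
  also have "\<dots> = (c\<^sup>2 * card G) * (c * (2 * D * K\<^sup>2))\<^sup>2 * D'"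
    by (simp add: D'_def power2_eq_square mult_ac)
  also have "\<dots> \<le> 1 * (c * (2 * D * K\<^sup>2))\<^sup>2 * D'"
    using c Dge by (intro mult_right_mono) auto
  also have "\<dots> = \<epsilon>\<^sup>2"
    using Dge by (simp add: \<epsilon>_def power_mult_distrib)
  finally have "sqrt (\<integral>y. (\<Sum>i\<in>G. Z i y)\<^sup>2 \<partial>M) \<le> \<epsilon>"
    using c Dge K by (intro real_le_lsqrt) (auto simp: \<epsilon>_def)
  moreover have "(\<integral>y. \<bar>\<Sum>i\<in>G. Z i y\<bar> \<partial>M) \<le> sqrt (\<integral>y. (\<Sum>i\<in>G. Z i y)\<^sup>2 \<partial>M)"
    using Zbd by (intro expectation_abs_le_sqrt[of _ "card G * (c\<^sup>2 * (2 * D * K\<^sup>2))"])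
      (auto intro!: order_trans[OF sum_abs] sum_bounded_above[THEN order_trans])
  ultimately have Z_le: "(\<integral>y. \<bar>\<Sum>i\<in>G. Z i y\<bar> \<partial>M) \<le> \<epsilon>" by linarith
  have XX: "(\<integral>y. X i y * X j y \<partial>M) = autocov U (j - i)" for i j
    unfolding X_def by (rule autocov_shift[OF U])
  have XX_int: "integrable M (\<lambda>y. X i y * X j y)" for i j
    using Xbd by (intro integrable_mult_bounded[of _ _ K K]) auto
  \<comment> \<open>The quadratic form has mean \<open>v\<close>, because pairs outside the
    neighbourhoods have covariance 0.\<close>
  have "v = c\<^sup>2 * (\<Sum>i\<in>G. \<Sum>j\<in>G. autocov U (j - i))"
    unfolding v_def S_def by (rule second_moment_sum[OF U bd])
  also have "(\<Sum>i\<in>G. \<Sum>j\<in>G. autocov U (j - i)) = (\<Sum>i\<in>G. \<Sum>j\<in>G \<inter> N i. autocov U (j - i))"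
    using G by (intro sum.cong sum.mono_neutral_right) (auto simp: N_def nbhd_iff autocov_eq_0)
  also have "\<dots> = (\<Sum>i\<in>G. \<integral>y. q i y \<partial>M)"
    unfolding q_def by (simp add: XX XX_int)
  finally have v_eq: "v = c\<^sup>2 * (\<Sum>i\<in>G. \<integral>y. q i y \<partial>M)" .
  have "Q y - v = (\<Sum>i\<in>G. Z i y)" for y
    unfolding Q_def v_eq Z_def q_def[symmetric] by (simp add: sum_distrib_left sum_subtractf right_diff_distrib)
  then have Qv: "(\<integral>y. \<bar>Q y - v\<bar> \<partial>M) \<le> \<epsilon>" using Z_le by simp
  \<comment> \<open>The exponential reads no coordinate in \<open>nbhd r i\<close>, so it is
    independent of \<open>X i\<close>, whose mean is 0.\<close>
  have far: "(CLINT y|M. X i y * iexp (s * (c * (\<Sum>j\<in>G - N i. X j y)))) = 0" for i s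
  proof -
    have "(CLINT y|M. X i y * iexp (s * (c * (\<Sum>j\<in>G - N i. X j y))))
        = (CLINT y|M. complex_of_real (X i y)) * (CLINT y|M. iexp (s * (c * (\<Sum>j\<in>G - N i. X j y))))"
    proof (rule integral_mult_disjoint[of _ _ K 1])
      show "depends_on (nbhd r i) (\<lambda>y. complex_of_real (X i y))" by (rule depends_on_comp[OF Xdep])
      show "depends_on (- nbhd r i) (\<lambda>y. iexp (s * (c * (\<Sum>j\<in>G - N i. X j y))))"
      proof (rule depends_on_comp[where h = "\<lambda>x. iexp (s * (c * x))"], rule depends_on_sum)
        fix j assume "j \<in> G - N i"
        then have "nbhd r i \<inter> nbhd r j = {}" by (intro nbhd_disjoint) (auto simp: N_def mult_2)
        then show "depends_on (- nbhd r i) (X j)" by (intro depends_on_mono[OF Xdep]) auto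
      qed
    qed (use Xbd in auto)
    then show ?thesis by (simp add: Xmean)
  qed
  have "cmod ((CLINT y|M. \<i> * S y * iexp (s * S y)) + (s * v) * (CLINT y|M. iexp (s * S y)))
    \<le> \<bar>s\<bar> * \<epsilon> + s\<^sup>2 * (card G * (c ^ 3 * (real ((4 * r + 1) ^ CARD('d)))\<^sup>2 * K ^ 3))" for s
    using stein_bound[OF G X Xbd c(1) cardN far Qv[unfolded Q_def], of s] by (simp add: S_eq)
  moreover have "card G * (c ^ 3 * (real ((4 * r + 1) ^ CARD('d)))\<^sup>2 * K ^ 3) \<le> c * (D\<^sup>2 * K ^ 3)"
  proof -
    have "card G * (c ^ 3 * (real ((4 * r + 1) ^ CARD('d)))\<^sup>2 * K ^ 3) = (c\<^sup>2 * card G) * (c * (D\<^sup>2 * K ^ 3))"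
      by (simp add: D_def power2_eq_square power3_eq_cube mult_ac)
    also have "\<dots> \<le> 1 * (c * (D\<^sup>2 * K ^ 3))" using c K Dge by (intro mult_right_mono) auto
    finally show ?thesis by simp
  qed
  ultimately have stein: "cmod ((CLINT y|M. \<i> * S y * iexp (s * S y)) + (s * v) * (CLINT y|M. iexp (s * S y)))
    \<le> \<bar>s\<bar> * \<epsilon> + s\<^sup>2 * (c * (D\<^sup>2 * K ^ 3))" for s
    by (meson add_left_mono mult_left_mono order_trans zero_le_power2)
  have Sbd: "\<bar>S y\<bar> \<le> c * (card G * K)" for y
    unfolding S_eq abs_mult using c Xbd
    by (intro mult_mono) (auto intro!: order_trans[OF sum_abs] sum_bounded_above[THEN order_trans])
  have "norm ((CLINT y|M. iexp (t * S y)) - of_real (exp (- v * t\<^sup>2 / 2)))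
      \<le> t\<^sup>2 * \<epsilon> + \<bar>t\<bar> ^ 3 * (c * (D\<^sup>2 * K ^ 3))"
  proof (rule gaussian_ode_bound[OF char_has_vector_derivative])
    show "\<bar>S y\<bar> \<le> c * (card G * K)" for y by (rule Sbd)
    show "v \<ge> 0" unfolding v_def by simp
    show "cmod ((CLINT y|M. \<i> * S y * iexp (s * S y)) + of_real (s * v) * (CLINT y|M. iexp (s * S y)))
      \<le> \<bar>s\<bar> * \<epsilon> + s\<^sup>2 * (c * (D\<^sup>2 * K ^ 3))" for s
      by (rule stein)
  qed (use c K Dge in \<open>auto simp: prob_space \<epsilon>_def\<close>)
  then show ?thesis by (simp add: v_def \<epsilon>_def algebra_simps exp_of_real)
qed

context
  fixes \<Gamma> :: "nat \<Rightarrow> (int ^ 'd) set"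
  assumes folner: "folner \<Gamma>"
begin

text \<open>By \<open>sum_differences\<close> the second moment is a finite sum of autocovariances
  weighted by Folner quotients, each of which tends to 1.\<close>

lemma finite_range_variance_tendsto:
  "(\<lambda>n. \<integral>y. (real (card (\<Gamma> n)) powr (- 1 / 2) * (\<Sum>i\<in>\<Gamma> n. U (shift_op i y)))\<^sup>2 \<partial>M)
    \<longlonglongrightarrow> (\<Sum>l\<in>box_set (2 * r). autocov U l)"
proof -
  have fin: "finite (\<Gamma> n)" for n using folner by (auto simp: folner_def)
  \<comment> \<open>This includes empty \<open>\<Gamma> n\<close>, where both sides are 0.\<close>
  have c2: "(real (card (\<Gamma> n)) powr (- 1 / 2))\<^sup>2 = 1 / card (\<Gamma> n)" for n
    by (simp add: power2_eq_square powr_minus_divide flip: powr_add)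
  have "(\<integral>y. (real (card (\<Gamma> n)) powr (- 1 / 2) * (\<Sum>i\<in>\<Gamma> n. U (shift_op i y)))\<^sup>2 \<partial>M)
     = (\<Sum>l\<in>box_set (2 * r). real (card (\<Gamma> n \<inter> (\<lambda>i. i - l) ` \<Gamma> n)) / card (\<Gamma> n) * autocov U l)" for n
  proof -
    have "(\<Sum>i\<in>\<Gamma> n. \<Sum>j\<in>\<Gamma> n. autocov U (j - i))
        = (\<Sum>l\<in>box_set (2 * r). card (\<Gamma> n \<inter> (\<lambda>i. i - l) ` \<Gamma> n) * autocov U l)"
      by (rule sum_differences[OF fin finite_box_set]) (rule autocov_eq_0)
    then show ?thesis
      unfolding second_moment_sum[OF U bd] c2 by (simp add: sum_distrib_left)
  qed
  moreover have "(\<lambda>n. \<Sum>l\<in>box_set (2 * r). real (card (\<Gamma> n \<inter> (\<lambda>i. i - l) ` \<Gamma> n)) / card (\<Gamma> n) * autocov U l)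
      \<longlonglongrightarrow> (\<Sum>l\<in>box_set (2 * r). 1 * autocov U l)"
    using folner by (intro tendsto_sum tendsto_mult tendsto_const) (auto simp: folner_def)
  ultimately show ?thesis by simp
qed

lemma finite_range_clt:
  "(\<lambda>n. CLINT y|M. iexp (t * (real (card (\<Gamma> n)) powr (- 1 / 2) * (\<Sum>i\<in>\<Gamma> n. U (shift_op i y)))))
    \<longlonglongrightarrow> complex_of_real (exp (- (\<Sum>l\<in>box_set (2 * r). autocov U l) * t\<^sup>2 / 2))"
proof -
  define c where "c n = real (card (\<Gamma> n)) powr (- 1 / 2)" for n
  define S where "S n y = c n * (\<Sum>i\<in>\<Gamma> n. U (shift_op i y))" for n y
  \<comment> \<open>\<open>C\<close> is free of \<open>n\<close>, so the Stein error
    \<open>c n * C\<close> vanishes with \<open>c n\<close>.\<close>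
  define C where "C = t\<^sup>2 * (2 * real ((4 * r + 1) ^ CARD('d)) * K\<^sup>2 * sqrt (real ((12 * r + 1) ^ CARD('d))))
    + \<bar>t\<bar> ^ 3 * ((real ((4 * r + 1) ^ CARD('d)))\<^sup>2 * K ^ 3)"
  have fin: "finite (\<Gamma> n)" for n using folner by (auto simp: folner_def)
  have c2: "(c n)\<^sup>2 = 1 / card (\<Gamma> n)" for n
    by (simp add: c_def power2_eq_square powr_minus_divide flip: powr_add)
  have "(\<lambda>n. sqrt ((c n)\<^sup>2)) \<longlonglongrightarrow> sqrt 0"
    unfolding c2 by (intro tendsto_real_sqrt folner_card folner)
  then have c0: "c \<longlonglongrightarrow> 0" by (simp add: c_def[abs_def])
  have bound: "cmod ((CLINT y|M. iexp (t * S n y)) - exp (- (\<integral>y. (S n y)\<^sup>2 \<partial>M) * t\<^sup>2 / 2)) \<le> c n * C" for n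
    unfolding S_def C_def
  proof (rule finite_range_char_bound[OF fin])
    show "c n \<ge> 0" by (simp add: c_def)
    show "(c n)\<^sup>2 * card (\<Gamma> n) \<le> 1" by (simp add: c2)
  qed
  have L1: "(\<lambda>n. (CLINT y|M. iexp (t * S n y)) - exp (- (\<integral>y. (S n y)\<^sup>2 \<partial>M) * t\<^sup>2 / 2)) \<longlonglongrightarrow> 0"
    by (rule Lim_null_comparison[OF _ tendsto_mult_left_zero[OF c0, of C]]) (use bound in auto)
  have L2: "(\<lambda>n. complex_of_real (exp (- (\<integral>y. (S n y)\<^sup>2 \<partial>M) * t\<^sup>2 / 2)))
      \<longlonglongrightarrow> exp (- (\<Sum>l\<in>box_set (2 * r). autocov U l) * t\<^sup>2 / 2)"
    using finite_range_variance_tendsto unfolding S_def c_def by (intro tendsto_intros) auto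
  show ?thesis
    using Lim_transform[OF L2 L1] unfolding S_def c_def .
qed

end

end

end

section \<open>Approximation by finite-range fields\<close>

definition rad :: "int ^ 'd \<Rightarrow> nat" where
  "rad i = (LEAST k. i \<in> box_set k)"

lemma rad_le_iff: "rad i \<le> k \<longleftrightarrow> i \<in> box_set k"
proof -
  \<comment> \<open>The largest absolute coordinate supplies a box containing \<open>i\<close>, so
    the \<open>LEAST\<close> is attained.\<close>
  have "\<bar>i $ c\<bar> \<le> int (nat (Max (range (\<lambda>c. \<bar>i $ c\<bar>))))" for c
  proof -
    have "\<bar>i $ c\<bar> \<le> Max (range (\<lambda>c. \<bar>i $ c\<bar>))" by (intro Max_ge) auto
    then show ?thesis by linarith
  qed
  then have "\<exists>k. i \<in> box_set k" unfolding box_set_iff by blast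
  then have "i \<in> box_set (rad i)" unfolding rad_def by (rule LeastI_ex)
  then show ?thesis
    using box_set_mono[of "rad i" k] by (auto simp: rad_def intro: Least_le)
qed

lemma power_diff_le:
  fixes a b :: real
  assumes "0 \<le> b" "b \<le> a"
  shows "a ^ n - b ^ n \<le> real n * (a - b) * a ^ (n - 1)"
proof (induction n)
  case (Suc n)
  have "a ^ Suc n - b ^ Suc n = a * (a ^ n - b ^ n) + (a - b) * b ^ n" by (simp add: algebra_simps)
  also have "\<dots> \<le> a * (real n * (a - b) * a ^ (n - 1)) + (a - b) * a ^ n"
    using assms Suc by (intro add_mono mult_left_mono power_mono) auto
  also have "\<dots> = real (Suc n) * (a - b) * a ^ (Suc n - 1)"
    by (cases n) (simp_all add: algebra_simps)
  finally show ?case .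
qed simp

text \<open>For \<open>k > 0\<close> a sphere is the difference of two consecutive boxes, of sides
  \<open>2 * k + 1\<close> and \<open>2 * k - 1\<close>. The weight \<open>Suc k\<close> also covers
  the single point at \<open>k = 0\<close>.\<close>

lemma card_sphere_le:
  "real (card {i :: int ^ 'd. rad i = k}) \<le> real CARD('d) * 2 ^ CARD('d) * real (Suc k) ^ (CARD('d) - 1)"
proof (cases k)
  case 0
  have "{i :: int ^ 'd. rad i = 0} = box_set 0" by (auto simp flip: rad_le_iff)
  moreover have "1 \<le> real CARD('d) * 2 ^ CARD('d)"
    using mult_mono[of 1 "real CARD('d)" 1 "2 ^ CARD('d)"] by (simp add: Suc_le_eq)
  ultimately show ?thesis using 0 by (simp add: box_set_0)
next
  case (Suc l)
  have "{i :: int ^ 'd. rad i = k} = box_set k - box_set l"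
    using Suc by (auto simp flip: rad_le_iff)
  then have "real (card {i :: int ^ 'd. rad i = k}) = real (2 * k + 1) ^ CARD('d) - real (2 * l + 1) ^ CARD('d)"
    using Suc by (simp add: card_Diff_subset finite_box_set box_set_mono card_box_set of_nat_diff power_mono)
  also have "\<dots> \<le> real CARD('d) * (real (2 * k + 1) - real (2 * l + 1)) * real (2 * k + 1) ^ (CARD('d) - 1)"
    using Suc by (intro power_diff_le) auto
  also have "\<dots> \<le> real CARD('d) * 2 * (2 * real (Suc k)) ^ (CARD('d) - 1)"
    using Suc by (intro mult_mono power_mono) auto
  also have "\<dots> = real CARD('d) * 2 ^ CARD('d) * real (Suc k) ^ (CARD('d) - 1)"
    unfolding power_mult_distrib by (simp add: power_eq_if[of 2 "CARD('d)"] del: of_nat_Suc)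
  finally show ?thesis .
qed

text \<open>Grouping by spheres turns the lattice sum into a series weighted by the sphere
  sizes.\<close>

lemma summable_on_rad:
  fixes g :: "nat \<Rightarrow> real"
  assumes nonneg: "\<And>k. g k \<ge> 0" and sm: "summable (\<lambda>k. real (Suc k) ^ (CARD('d) - 1) * g k)"
  shows "(\<lambda>i :: int ^ 'd. g (rad i)) summable_on UNIV"
proof (rule nonneg_bdd_above_summable_on)
  define C where "C = real CARD('d) * 2 ^ CARD('d)"
  define h where "h k = real (Suc k) ^ (CARD('d) - 1) * g k" for k
  show "bdd_above (sum (\<lambda>i :: int ^ 'd. g (rad i)) ` {F. F \<subseteq> UNIV \<and> finite F})"
  proof (rule bdd_aboveI2)
    fix F :: "(int ^ 'd) set" assume "F \<in> {F. F \<subseteq> UNIV \<and> finite F}"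
    then have F: "finite F" by simp
    have fin: "finite {i :: int ^ 'd. rad i = k}" for k
      by (rule finite_subset[OF _ finite_box_set[of k]]) (auto simp flip: rad_le_iff)
    have "(\<Sum>i\<in>F. g (rad i)) = (\<Sum>k\<in>rad ` F. \<Sum>i\<in>{i \<in> F. rad i = k}. g (rad i))"
      using F by (rule sum.image_gen)
    also have "\<dots> = (\<Sum>k\<in>rad ` F. real (card {i \<in> F. rad i = k}) * g k)"
      by (intro sum.cong) auto
    also have "\<dots> \<le> (\<Sum>k\<in>rad ` F. C * h k)"
    proof (rule sum_mono)
      fix k
      have "real (card {i \<in> F. rad i = k}) \<le> real (card {i :: int ^ 'd. rad i = k})"
        using fin by (intro of_nat_mono card_mono) auto
      also have "\<dots> \<le> C * real (Suc k) ^ (CARD('d) - 1)"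
        unfolding C_def by (rule card_sphere_le)
      finally have "real (card {i \<in> F. rad i = k}) * g k \<le> C * real (Suc k) ^ (CARD('d) - 1) * g k"
        using nonneg[of k] by (rule mult_right_mono)
      then show "real (card {i \<in> F. rad i = k}) * g k \<le> C * h k"
        unfolding h_def mult.assoc .
    qed
    also have "\<dots> \<le> (\<Sum>k. C * h k)"
      using sm nonneg F unfolding h_def C_def by (intro sum_le_suminf summable_mult) auto
    finally show "(\<Sum>i\<in>F. g (rad i)) \<le> (\<Sum>k. C * h k)" .
  qed
qed (use nonneg in auto)

text \<open>The new series repeats each term of \<open>h\<close> exactly \<open>q\<close>
  times.\<close>

lemma summable_div:
  fixes h :: "nat \<Rightarrow> real"
  assumes "\<And>k. h k \<ge> 0" "summable h" "q > 0"
  shows "summable (\<lambda>k. h (k div q))"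
proof (rule summableI_nonneg_bounded)
  have block: "(\<Sum>k<q * n. h (k div q)) = q * (\<Sum>k<n. h k)" for n
  proof (induction n)
    case (Suc n)
    have "{..<q * Suc n} = {..<q * n} \<union> {q * n..<q * n + q}" by auto
    then have "(\<Sum>k<q * Suc n. h (k div q)) = (\<Sum>k<q * n. h (k div q)) + (\<Sum>k\<in>{q * n..<q * n + q}. h (k div q))"
      by (simp add: sum.union_disjoint ivl_disj_int)
    also have "(\<Sum>k\<in>{q * n..<q * n + q}. h (k div q)) = (\<Sum>k\<in>{q * n..<q * n + q}. h n)"
      using \<open>q > 0\<close> by (intro sum.cong refl arg_cong[of _ _ h] div_nat_eqI) (auto simp: mult.commute)
    finally show ?case using Suc by (simp add: algebra_simps)
  qed simp
  fix n
  have "(\<Sum>k<n. h (k div q)) \<le> (\<Sum>k<q * n. h (k div q))"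
    using assms by (intro sum_mono2) (auto intro: order_less_le_trans)
  also have "\<dots> \<le> q * (\<Sum>k. h k)"
    unfolding block using assms by (intro mult_left_mono sum_le_suminf) auto
  finally show "(\<Sum>k<n. h (k div q)) \<le> q * (\<Sum>k. h k)" .
qed (use assms in auto)

lemma summable_on_rad_div:
  fixes \<gamma> :: "nat \<Rightarrow> real"
  assumes nonneg: "\<And>k. \<gamma> k \<ge> 0" and sm: "summable (\<lambda>k. real (Suc k) ^ (CARD('d) - 1) * \<gamma> k)"
  shows "(\<lambda>i :: int ^ 'd. \<gamma> ((rad i - 1) div 4)) summable_on UNIV"
proof (rule summable_on_rad)
  define h where "h k = real (Suc k) ^ (CARD('d) - 1) * \<gamma> k" for k
  have "summable (\<lambda>k. h (k div 4))"
    using nonneg sm unfolding h_def by (intro summable_div) auto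
  then have sm': "summable (\<lambda>k. 8 ^ (CARD('d) - 1) * h (k div 4))"
    by (rule summable_mult)
  \<comment> \<open>The term at 0 is split off, which turns \<open>k - 1\<close> into
    \<open>k\<close>. The constant 8 comes from
    \<open>k + 2 \<le> 8 * (k div 4 + 1)\<close>.\<close>
  have "summable (\<lambda>k. real (Suc (Suc k)) ^ (CARD('d) - 1) * \<gamma> ((Suc k - 1) div 4))"
  proof (rule summable_comparison_test'[OF sm', of 0])
    fix k :: nat
    have "Suc (Suc k) \<le> 8 * Suc (k div 4)" by presburger
    from of_nat_mono[OF this, where ?'a = real]
    have "real (Suc (Suc k)) \<le> 8 * real (Suc (k div 4))" by simp
    then have "real (Suc (Suc k)) ^ (CARD('d) - 1) \<le> 8 ^ (CARD('d) - 1) * real (Suc (k div 4)) ^ (CARD('d) - 1)"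
      unfolding power_mult_distrib[symmetric] by (intro power_mono) auto
    then show "norm (real (Suc (Suc k)) ^ (CARD('d) - 1) * \<gamma> ((Suc k - 1) div 4)) \<le> 8 ^ (CARD('d) - 1) * h (k div 4)"
      using nonneg[of "k div 4"] unfolding h_def by (simp add: mult_right_mono flip: mult.assoc)
  qed
  then show "summable (\<lambda>k. real (Suc k) ^ (CARD('d) - 1) * \<gamma> ((k - 1) div 4))"
    by (subst (asm) summable_Suc_iff)
qed (use nonneg in auto)

text \<open>Dominated convergence for sums: a finite set carries all but \<open>e / 2\<close> of the
  dominating sum, and on it the terms tend to 0 together.\<close>

lemma infsum_tendsto_0_dominated:
  fixes g :: "nat \<Rightarrow> 'i \<Rightarrow> real"
  assumes a: "a summable_on UNIV" and g: "\<And>k i. 0 \<le> g k i" "\<And>k i. g k i \<le> a i"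
    and lim: "\<And>i. (\<lambda>k. g k i) \<longlonglongrightarrow> 0"
  shows "(\<lambda>k. infsum (g k) UNIV) \<longlonglongrightarrow> 0"
proof (rule LIMSEQ_I)
  fix e :: real assume e: "e > 0"
  have sg: "g k summable_on A" for k A
    using g by (intro summable_on_comparison_test[OF summable_on_subset_banach[OF a]]) auto
  have "(sum a \<longlongrightarrow> infsum a UNIV) (finite_subsets_at_top UNIV)"
    using a by (simp add: has_sum_def[symmetric] has_sum_infsum)
  then have "\<forall>\<^sub>F F in finite_subsets_at_top UNIV. dist (sum a F) (infsum a UNIV) < e / 2"
    using e by (intro tendstoD) auto
  then obtain F where F: "finite F" "\<bar>sum a F - infsum a UNIV\<bar> < e / 2"
    by (auto simp: eventually_finite_subsets_at_top dist_real_def)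
  have "(\<lambda>k. \<Sum>i\<in>F. g k i) \<longlonglongrightarrow> (\<Sum>i\<in>F. 0)" by (intro tendsto_sum lim)
  then have "(\<lambda>k. \<Sum>i\<in>F. g k i) \<longlonglongrightarrow> 0" by simp
  from LIMSEQ_D[OF this half_gt_zero[OF e]] obtain k0
    where k0: "\<And>k. k \<ge> k0 \<Longrightarrow> norm ((\<Sum>i\<in>F. g k i) - 0) < e / 2" by blast
  have split: "infsum f UNIV = sum f F + infsum f (- F)" if "f summable_on UNIV" for f :: "'i \<Rightarrow> real"
    using infsum_Un_disjoint[of f F "- F"] F(1) that
    by (simp add: summable_on_subset_banach[OF that])
  have "norm (infsum (g k) UNIV - 0) < e" if "k \<ge> k0" for k
  proof -
    have "infsum (g k) (- F) \<le> infsum a (- F)"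
      using g by (intro infsum_mono sg summable_on_subset_banach[OF a]) auto
    then have "infsum (g k) UNIV < e"
      using k0[OF that] F(2) split[OF sg] split[OF a] by auto
    then show ?thesis using infsum_nonneg[of UNIV "g k"] g by simp
  qed
  then show "\<exists>no. \<forall>k\<ge>no. norm (infsum (g k) UNIV - 0) < e" by blast
qed

text \<open>An interchange of limits: \<open>e k\<close> bounds the error uniformly in
  \<open>n\<close>, so a good \<open>k\<close> can be fixed before \<open>n\<close> grows.\<close>

lemma tendsto_approximation:
  fixes x :: "nat \<Rightarrow> 'b::real_normed_vector"
  assumes xk: "\<And>k. x' k \<longlonglongrightarrow> y' k" and y: "y' \<longlonglongrightarrow> y"
    and e: "e \<longlonglongrightarrow> 0" and bd: "\<And>k n. norm (x n - x' k n) \<le> e k"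
  shows "x \<longlonglongrightarrow> y"
proof (rule LIMSEQ_I)
  fix r :: real assume r: "r > 0"
  have "r / 3 > 0" using r by simp
  then have "\<forall>\<^sub>F k in sequentially. dist (y' k) y < r / 3 \<and> dist (e k) 0 < r / 3"
    by (intro eventually_conj tendstoD[OF y] tendstoD[OF e])
  then obtain k where k: "norm (y' k - y) < r / 3" "\<bar>e k\<bar> < r / 3"
    by (auto simp: dist_norm dest!: eventually_happens)
  from LIMSEQ_D[OF xk[of k], of "r / 3"] r obtain N
    where N: "\<And>n. n \<ge> N \<Longrightarrow> norm (x' k n - y' k) < r / 3" by auto
  have "norm (x n - y) < r" if "n \<ge> N" for n
  proof -
    show ?thesis
      using k N[OF that] bd[of n k] norm_triangle_ineq[of "x n - x' k n" "x' k n - y' k"]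
        norm_triangle_ineq[of "x n - y' k" "y' k - y"]
      by simp
  qed
  then show "\<exists>N. \<forall>n\<ge>N. norm (x n - y) < r" by blast
qed

lemma norm_iexp_diff_le: "cmod (iexp a - iexp b) \<le> \<bar>a - b\<bar>"
proof -
  have "iexp a - iexp b = iexp b * (iexp (a - b) - 1)" by (simp add: algebra_simps flip: exp_add)
  then have "cmod (iexp a - iexp b) = cmod (iexp (a - b) - 1)" by (simp add: norm_mult)
  then show ?thesis using iexp_approx1[of "a - b" 0] by simp
qed

context iid_field
begin

text \<open>The difference of products is split by changing one factor at a time; by stationarity
  the translated pair has the same mean distance as the original pair.\<close>

lemma autocov_diff_le:
  assumes [measurable]: "f \<in> borel_measurable M" "g \<in> borel_measurable M"
    and bd: "\<And>y. \<bar>f y\<bar> \<le> L" "\<And>y. \<bar>g y\<bar> \<le> L"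
  shows "\<bar>autocov f i - autocov g i\<bar> \<le> 2 * L * (\<integral>y. \<bar>f y - g y\<bar> \<partial>M)"
proof -
  have ip: "integrable M (\<lambda>y. f y * f (shift_op i y))" "integrable M (\<lambda>y. g y * g (shift_op i y))"
    using bd by (auto intro!: integrable_mult_bounded[of _ _ L L])
  have id: "integrable M (\<lambda>y. \<bar>f y - g y\<bar>)"
    using bd by (intro integrable_abs Bochner_Integration.integrable_diff integrable_bounded[of _ L]) auto
  have ids: "integrable M (\<lambda>y. \<bar>f (shift_op i y) - g (shift_op i y)\<bar>)"
    using bd by (intro integrable_abs Bochner_Integration.integrable_diff integrable_bounded[of _ L]) auto
  have "\<bar>autocov f i - autocov g i\<bar> = \<bar>\<integral>y. f y * f (shift_op i y) - g y * g (shift_op i y) \<partial>M\<bar>"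
    using ip by (simp add: autocov_def)
  also have "\<dots> \<le> (\<integral>y. \<bar>f y * f (shift_op i y) - g y * g (shift_op i y)\<bar> \<partial>M)"
    by (rule integral_abs_bound)
  also have "\<dots> \<le> (\<integral>y. L * \<bar>f (shift_op i y) - g (shift_op i y)\<bar> + L * \<bar>f y - g y\<bar> \<partial>M)"
  proof (rule integral_mono)
    fix y
    have eq: "f y * f (shift_op i y) - g y * g (shift_op i y)
        = f y * (f (shift_op i y) - g (shift_op i y)) + (f y - g y) * g (shift_op i y)"
      by (simp add: algebra_simps)
    have "\<bar>f y * f (shift_op i y) - g y * g (shift_op i y)\<bar> \<le> \<bar>f y\<bar> * \<bar>f (shift_op i y) - g (shift_op i y)\<bar> + \<bar>f y - g y\<bar> * \<bar>g (shift_op i y)\<bar>"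
      unfolding eq abs_mult[symmetric] by (rule abs_triangle_ineq)
    also have "\<dots> \<le> L * \<bar>f (shift_op i y) - g (shift_op i y)\<bar> + \<bar>f y - g y\<bar> * L"
      by (intro add_mono mult_right_mono[OF bd(1)] mult_left_mono[OF bd(2)] abs_ge_zero)
    finally show "\<bar>f y * f (shift_op i y) - g y * g (shift_op i y)\<bar>
        \<le> L * \<bar>f (shift_op i y) - g (shift_op i y)\<bar> + L * \<bar>f y - g y\<bar>" by (simp add: mult.commute)
  qed (use ip id ids in auto)
  also have "\<dots> = L * (\<integral>y. \<bar>f (shift_op i y) - g (shift_op i y)\<bar> \<partial>M) + L * (\<integral>y. \<bar>f y - g y\<bar> \<partial>M)"
    using id ids by simp
  also have "(\<integral>y. \<bar>f (shift_op i y) - g (shift_op i y)\<bar> \<partial>M) = (\<integral>y. \<bar>f y - g y\<bar> \<partial>M)"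
    by (rule integral_shift) measurable
  finally show ?thesis by simp
qed

section \<open>Approximation of a stationary field by averages over boxes, uniformly along the
  Folner sequence\<close>

context
  fixes V :: "(int ^ 'd \<Rightarrow> 'l) \<Rightarrow> real" and K :: real and \<gamma> :: "nat \<Rightarrow> real" and \<Gamma> :: "nat \<Rightarrow> (int ^ 'd) set"
  assumes V [measurable]: "V \<in> borel_measurable M" and bd: "\<And>y. \<bar>V y\<bar> \<le> K"
    and mean: "(\<integral>y. V y \<partial>M) = 0"
    and approx: "\<And>k. (\<integral>y. \<bar>V y - avg (box_set (2 * k)) V y\<bar> \<partial>M) \<le> \<gamma> k"
    and dec: "decseq \<gamma>" and sm: "summable (\<lambda>k. real (Suc k) ^ (CARD('d) - 1) * \<gamma> k)"
    and folner: "folner \<Gamma>"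
begin

text \<open>The radius is \<open>2 * k\<close> because a coordinate of the factor image in
  \<open>box_set k\<close> with coding radius at most \<open>k\<close> is decided by
  \<open>box_set (2 * k)\<close>. The autocovariance of \<open>Z k\<close> then vanishes outside
  \<open>box_set (4 * k)\<close>.\<close>

abbreviation "Z k \<equiv> avg (box_set (2 * k)) V"

text \<open>For \<open>i\<close> other than 0, \<open>m = (rad i - 1) div 4\<close> satisfies
  \<open>4 * m < rad i\<close>, so \<open>Z m\<close> is uncorrelated with its translate by
  \<open>i\<close>. The rate is taken at the larger of \<open>k\<close> and \<open>m\<close>, where
  the decreasing \<open>\<gamma>\<close> is smaller.\<close>

abbreviation gap :: "nat \<Rightarrow> int ^ 'd \<Rightarrow> real" where
  "gap k i \<equiv> \<gamma> (max k ((rad i - 1) div 4))"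

lemma K_nonneg: "K \<ge> 0" using bd[of undefined] by linarith

lemma gamma_nonneg: "\<gamma> k \<ge> 0"
  by (rule order_trans[OF _ approx[of k]]) simp

lemma gamma_tendsto_0: "\<gamma> \<longlonglongrightarrow> 0"
proof (rule tendsto_sandwich[OF _ _ tendsto_const summable_LIMSEQ_zero[OF sm]])
  have "1 * \<gamma> k \<le> real (Suc k) ^ (CARD('d) - 1) * \<gamma> k" for k
    using gamma_nonneg by (intro mult_right_mono one_le_power) auto
  then show "\<forall>\<^sub>F k in sequentially. \<gamma> k \<le> real (Suc k) ^ (CARD('d) - 1) * \<gamma> k" by simp
qed (simp add: gamma_nonneg)

lemma Z_props: "Z k \<in> borel_measurable M" "\<bar>Z k y\<bar> \<le> K" "depends_on (box_set (2 * k)) (Z k)"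
    "(\<integral>y. Z k y \<partial>M) = 0"
proof -
  show "Z k \<in> borel_measurable M" by (rule avg_measurable[OF V bd])
  show "\<bar>Z k y\<bar> \<le> K" by (rule avg_bound[OF V bd])
  show "depends_on (box_set (2 * k)) (Z k)" by (rule depends_on_avg)
  show "(\<integral>y. Z k y \<partial>M) = 0" unfolding integral_avg[OF V bd] by (rule mean)
qed

lemma autocov_Z_eq_0: "i \<notin> box_set (4 * k) \<Longrightarrow> autocov (Z k) i = 0"
  using autocov_eq_0[OF Z_props(1-4)] by simp

lemma far_of_index:
  assumes "k < (rad i - 1) div 4"
  shows "i \<notin> box_set (4 * ((rad i - 1) div 4))" "i \<notin> box_set (4 * k)"
proof -
  define m where "m = (rad i - 1) div 4"
  have "4 * m \<le> rad i - 1" unfolding m_def by (rule times_div_less_eq_dividend)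
  with assms show "i \<notin> box_set (4 * ((rad i - 1) div 4))" "i \<notin> box_set (4 * k)"
    unfolding rad_le_iff[symmetric] m_def[symmetric] by linarith+
qed

text \<open>If \<open>k < m\<close> for the index \<open>m\<close> in \<open>gap\<close>, the
  autocovariances of \<open>Z k\<close> and \<open>Z m\<close> at \<open>i\<close> are both 0, so
  \<open>Z k\<close> may be exchanged for \<open>Z m\<close>.\<close>

lemma autocov_V_Z: "\<bar>autocov V i - autocov (Z k) i\<bar> \<le> 2 * K * gap k i"
proof (cases "k < (rad i - 1) div 4")
  case True
  let ?m = "(rad i - 1) div 4"
  have "autocov V i - autocov (Z k) i = autocov V i - autocov (Z ?m) i"
    using far_of_index[OF True] by (simp add: autocov_Z_eq_0)
  also have "\<bar>\<dots>\<bar> \<le> 2 * K * (\<integral>y. \<bar>V y - Z ?m y\<bar> \<partial>M)"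
    by (rule autocov_diff_le[OF V Z_props(1) bd Z_props(2)])
  also have "\<dots> \<le> 2 * K * \<gamma> ?m" using approx K_nonneg by (intro mult_left_mono) auto
  finally show ?thesis using True by (simp add: max_def)
next
  case False
  have "\<bar>autocov V i - autocov (Z k) i\<bar> \<le> 2 * K * (\<integral>y. \<bar>V y - Z k y\<bar> \<partial>M)"
    by (rule autocov_diff_le[OF V Z_props(1) bd Z_props(2)])
  also have "\<dots> \<le> 2 * K * \<gamma> k" using approx K_nonneg by (intro mult_left_mono) auto
  finally show ?thesis using False by (simp add: max_def)
qed

lemma autocov_remainder: "\<bar>autocov (\<lambda>y. V y - Z k y) i\<bar> \<le> 4 * K * gap k i"
proof -
  note [measurable] = Z_props(1)
  have W: "(\<lambda>y. V y - Z k y) \<in> borel_measurable M" for k by measurable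
  have Wbd: "\<bar>V y - Z k y\<bar> \<le> 2 * K" for k y
    using bd[of y] Z_props(2)[of k y] by linarith
  show ?thesis
  proof (cases "k < (rad i - 1) div 4")
    case True
    let ?m = "(rad i - 1) div 4"
    \<comment> \<open>This field has range too short to correlate at lag \<open>i\<close>, and it
      differs from the remainder \<open>V - Z k\<close> exactly by \<open>V - Z m\<close>.\<close>
    let ?U = "\<lambda>y. Z ?m y - Z k y"
    have U: "?U \<in> borel_measurable M" by measurable
    have Ubd: "\<bar>?U y\<bar> \<le> 2 * K" for y
      using Z_props(2)[of ?m y] Z_props(2)[of k y] by linarith
    have "depends_on (box_set (2 * ?m)) (Z k)"
      using True by (intro depends_on_mono[OF Z_props(3)] box_set_mono) auto
    then have Udep: "depends_on (box_set (2 * ?m)) ?U"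
      by (rule depends_on_comp2[where h = "(-)", OF Z_props(3)])
    have int: "integrable M (Z l)" for l
      using Z_props(2) by (intro integrable_bounded[of _ K]) auto
    have "(\<integral>y. ?U y \<partial>M) = 0" using int Z_props(4) by simp
    then have "autocov ?U i = 0"
      using autocov_eq_0[OF U Ubd Udep] far_of_index[OF True] by simp
    then have "\<bar>autocov (\<lambda>y. V y - Z k y) i\<bar> = \<bar>autocov (\<lambda>y. V y - Z k y) i - autocov ?U i\<bar>" by simp
    also have "\<dots> \<le> 2 * (2 * K) * (\<integral>y. \<bar>(V y - Z k y) - ?U y\<bar> \<partial>M)"
      by (rule autocov_diff_le[OF W U Wbd Ubd])
    also have "\<dots> \<le> 4 * K * \<gamma> ?m" using approx[of ?m] K_nonneg by (simp add: mult_left_mono)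
    finally show ?thesis using True by (simp add: max_def)
  next
    case False
    \<comment> \<open>Here the remainder is compared with the zero field.\<close>
    have "\<bar>autocov (\<lambda>y. V y - Z k y) i - autocov (\<lambda>y. 0) i\<bar> \<le> 2 * (2 * K) * (\<integral>y. \<bar>(V y - Z k y) - 0\<bar> \<partial>M)"
      using K_nonneg by (intro autocov_diff_le[OF W _ Wbd]) auto
    also have "\<dots> \<le> 4 * K * \<gamma> k" using approx[of k] K_nonneg by (simp add: mult_left_mono)
    finally show ?thesis using False by (simp add: max_def autocov_def)
  qed
qed

lemma gap_nonneg: "gap k i \<ge> 0" by (rule gamma_nonneg)

lemma gap_le: "gap k i \<le> \<gamma> ((rad i - 1) div 4)"
  using dec by (auto simp: decseq_def)

lemma summable_on_index: "(\<lambda>i :: int ^ 'd. \<gamma> ((rad i - 1) div 4)) summable_on UNIV"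
  by (rule summable_on_rad_div[OF gamma_nonneg sm])

lemma summable_on_gap: "gap k summable_on (UNIV :: (int ^ 'd) set)"
  using gap_nonneg gap_le by (intro summable_on_comparison_test[OF summable_on_index])

text \<open>Controls both the error in the asymptotic variance and the mean square of the normalised
  remainder sums, independently of the summation set.\<close>

definition total_gap :: "nat \<Rightarrow> real" where
  "total_gap k = (\<Sum>\<^sub>\<infinity>i :: int ^ 'd. gap k i)"

lemma total_gap_tendsto_0: "total_gap \<longlonglongrightarrow> 0"
  unfolding total_gap_def[abs_def]
proof (rule infsum_tendsto_0_dominated[OF summable_on_index gap_nonneg gap_le])
  fix i :: "int ^ 'd"
  show "(\<lambda>k. gap k i) \<longlonglongrightarrow> 0"
  proof (rule tendsto_sandwich[OF _ _ tendsto_const gamma_tendsto_0])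
    show "\<forall>\<^sub>F k in sequentially. gap k i \<le> \<gamma> k"
      using dec by (auto simp: decseq_def)
  qed (simp add: gamma_nonneg)
qed

lemma summable_autocov_Z: "autocov (Z k) summable_on UNIV"
  by (rule summable_on_cong_neutral[THEN iffD1, OF _ _ _ summable_on_finite[OF finite_box_set[of "4 * k"]]])
    (auto simp: autocov_Z_eq_0)

lemma summable_autocov_V_Z: "(\<lambda>i. autocov V i - autocov (Z k) i) summable_on UNIV"
proof (rule abs_summable_summable, rule summable_on_comparison_test)
  show "(\<lambda>i. 2 * K * gap k i) summable_on UNIV"
    by (intro summable_on_cmult_right summable_on_gap)
qed (simp_all add: autocov_V_Z del: One_nat_def)

text \<open>The autocovariance of \<open>Z 0\<close> has finite support, and the difference is
  dominated by a multiple of \<open>gap 0\<close>.\<close>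

lemma summable_autocov: "autocov V summable_on UNIV"
  using summable_on_add[OF summable_autocov_V_Z[of 0] summable_autocov_Z[of 0]] by simp

text \<open>The box is \<open>2 * r\<close> with \<open>r = 2 * k\<close>, the form in which the
  finite-range results deliver the limiting variance.\<close>

lemma sum_autocov_Z: "(\<Sum>i\<in>box_set (2 * (2 * k)). autocov (Z k) i) = infsum (autocov (Z k)) UNIV"
  unfolding infsum_finite[OF finite_box_set, symmetric]
  by (rule infsum_cong_neutral) (auto simp: autocov_Z_eq_0)

lemma sum_autocov_Z_tendsto:
  "(\<lambda>k. \<Sum>i\<in>box_set (2 * (2 * k)). autocov (Z k) i) \<longlonglongrightarrow> infsum (autocov V) UNIV"
proof (rule LIM_zero_cancel, rule Lim_null_comparison)
  have "\<bar>infsum (autocov V) UNIV - infsum (autocov (Z k)) UNIV\<bar> \<le> 2 * K * total_gap k" for k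
  proof -
    have "\<bar>\<Sum>\<^sub>\<infinity>i. autocov V i - autocov (Z k) i\<bar> \<le> (\<Sum>\<^sub>\<infinity>i. 2 * K * gap k i)"
      unfolding real_norm_def[symmetric]
      by (rule norm_infsum_le[OF has_sum_infsum[OF summable_autocov_V_Z] has_sum_infsum])
        (rule summable_on_cmult_right[OF summable_on_gap], simp add: autocov_V_Z del: One_nat_def)
    moreover have "infsum (autocov V) UNIV = (\<Sum>\<^sub>\<infinity>i. autocov V i - autocov (Z k) i) + infsum (autocov (Z k)) UNIV"
      using infsum_add[OF summable_autocov_V_Z[of k] summable_autocov_Z[of k]] by simp
    ultimately show ?thesis
      by (simp add: total_gap_def infsum_cmult_right')
  qed
  then show "\<forall>\<^sub>F k in sequentially. norm ((\<Sum>i\<in>box_set (2 * (2 * k)). autocov (Z k) i) - infsum (autocov V) UNIV)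
      \<le> 2 * K * total_gap k"
    unfolding sum_autocov_Z by (simp add: abs_minus_commute)
  show "(\<lambda>k. 2 * K * total_gap k) \<longlonglongrightarrow> 0"
    using tendsto_mult_right_zero[OF total_gap_tendsto_0] .
qed

text \<open>For each \<open>k\<close> the finite sum is a limit of second moments along
  \<open>\<Gamma>\<close>; nonnegativity then passes to the limit in \<open>k\<close>.\<close>

lemma infsum_autocov_nonneg: "infsum (autocov V) UNIV \<ge> 0"
proof (rule LIMSEQ_le_const[OF sum_autocov_Z_tendsto], intro exI allI impI)
  show "0 \<le> (\<Sum>i\<in>box_set (2 * (2 * k)). autocov (Z k) i)" for k
    by (rule LIMSEQ_le_const[OF finite_range_variance_tendsto[OF Z_props(1-4) folner]]) simp
qed

text \<open>For fixed \<open>i\<close> the differences \<open>j - i\<close> are distinct, so each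
  inner sum is at most a multiple of the full lattice sum of \<open>gap k\<close>; the normalisation
  absorbs the outer sum. The bound does not involve \<open>G\<close>.\<close>

lemma remainder_second_moment:
  fixes c :: real
  assumes G: "finite G" and c: "c\<^sup>2 * card G \<le> 1"
  shows "(\<integral>y. (c * (\<Sum>i\<in>G. V (shift_op i y) - Z k (shift_op i y)))\<^sup>2 \<partial>M) \<le> 4 * K * total_gap k"
proof -
  note [measurable] = Z_props(1)
  have T: "total_gap k \<ge> 0" unfolding total_gap_def by (intro infsum_nonneg gap_nonneg)
  have "(\<integral>y. (c * (\<Sum>i\<in>G. V (shift_op i y) - Z k (shift_op i y)))\<^sup>2 \<partial>M)
      = c\<^sup>2 * (\<Sum>i\<in>G. \<Sum>j\<in>G. autocov (\<lambda>y. V y - Z k y) (j - i))"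
  proof (rule second_moment_sum)
    show "\<bar>V y - Z k y\<bar> \<le> 2 * K" for y using bd[of y] Z_props(2)[of k y] by linarith
  qed measurable
  also have "\<dots> \<le> c\<^sup>2 * (\<Sum>i\<in>G. 4 * K * total_gap k)"
  proof (intro mult_left_mono sum_mono)
    fix i
    have "(\<Sum>j\<in>G. autocov (\<lambda>y. V y - Z k y) (j - i)) \<le> (\<Sum>j\<in>G. 4 * K * gap k (j - i))"
      by (intro sum_mono) (use autocov_remainder in \<open>auto dest: abs_le_D1\<close>)
    also have "\<dots> = 4 * K * (\<Sum>l\<in>(\<lambda>j. j - i) ` G. gap k l)"
      by (simp add: sum_distrib_left sum.reindex inj_on_def)
    also have "\<dots> \<le> 4 * K * total_gap k"
      unfolding total_gap_def using K_nonneg G gap_nonneg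
      by (intro mult_left_mono finite_sum_le_infsum summable_on_gap) auto
    finally show "(\<Sum>j\<in>G. autocov (\<lambda>y. V y - Z k y) (j - i)) \<le> 4 * K * total_gap k" .
  qed simp
  also have "\<dots> = (c\<^sup>2 * card G) * (4 * K * total_gap k)" by simp
  also have "\<dots> \<le> 1 * (4 * K * total_gap k)"
    using c T K_nonneg by (intro mult_right_mono) auto
  finally show ?thesis by simp
qed

text \<open>Replacing \<open>V\<close> by \<open>Z k\<close> changes the characteristic function by
  at most |t| times the mean distance of the normalised sums, hence by |t| times the root of the
  remainder's second moment. This is uniform in \<open>n\<close>, as
  \<open>tendsto_approximation\<close> requires.\<close>

lemma char_tendsto:
  "(\<lambda>n. CLINT y|M. iexp (t * (real (card (\<Gamma> n)) powr (- 1 / 2) * (\<Sum>i\<in>\<Gamma> n. V (shift_op i y)))))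
    \<longlonglongrightarrow> complex_of_real (exp (- (infsum (autocov V) UNIV) * t\<^sup>2 / 2))"
proof (rule tendsto_approximation)
  note [measurable] = Z_props(1)
  define c where "c n = real (card (\<Gamma> n)) powr (- 1 / 2)" for n
  show "(\<lambda>n. CLINT y|M. iexp (t * (real (card (\<Gamma> n)) powr (- 1 / 2) * (\<Sum>i\<in>\<Gamma> n. Z k (shift_op i y)))))
    \<longlonglongrightarrow> complex_of_real (exp (- (\<Sum>i\<in>box_set (2 * (2 * k)). autocov (Z k) i) * t\<^sup>2 / 2))" for k
    by (rule finite_range_clt[OF Z_props(1-4) folner])
  show "(\<lambda>k. complex_of_real (exp (- (\<Sum>i\<in>box_set (2 * (2 * k)). autocov (Z k) i) * t\<^sup>2 / 2)))
    \<longlonglongrightarrow> complex_of_real (exp (- (infsum (autocov V) UNIV) * t\<^sup>2 / 2))"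
    by (intro tendsto_intros sum_autocov_Z_tendsto) simp
  have "(\<lambda>k. \<bar>t\<bar> * sqrt (4 * K * total_gap k)) \<longlonglongrightarrow> \<bar>t\<bar> * sqrt (4 * K * 0)"
    by (intro tendsto_intros total_gap_tendsto_0)
  then show "(\<lambda>k. \<bar>t\<bar> * sqrt (4 * K * total_gap k)) \<longlonglongrightarrow> 0" by simp
  fix k n
  have fin: "finite (\<Gamma> n)" using folner by (auto simp: folner_def)
  have c2: "(c n)\<^sup>2 * card (\<Gamma> n) \<le> 1"
    by (simp add: c_def power2_eq_square powr_minus_divide flip: powr_add)
  define S where "S y = c n * (\<Sum>i\<in>\<Gamma> n. V (shift_op i y))" for y
  define S' where "S' y = c n * (\<Sum>i\<in>\<Gamma> n. Z k (shift_op i y))" for y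
  have [measurable]: "S \<in> borel_measurable M" "S' \<in> borel_measurable M"
    unfolding S_def S'_def by measurable
  have diff: "S y - S' y = c n * (\<Sum>i\<in>\<Gamma> n. V (shift_op i y) - Z k (shift_op i y))" for y
    by (simp add: S_def S'_def sum_subtractf right_diff_distrib)
  have dbd: "\<bar>S y - S' y\<bar> \<le> \<bar>c n\<bar> * (card (\<Gamma> n) * (2 * K))" for y
    unfolding diff abs_mult
  proof (rule mult_left_mono)
    have "\<bar>V x - Z k x\<bar> \<le> 2 * K" for x using bd[of x] Z_props(2)[of k x] by linarith
    then show "\<bar>\<Sum>i\<in>\<Gamma> n. V (shift_op i y) - Z k (shift_op i y)\<bar> \<le> card (\<Gamma> n) * (2 * K)"
      by (intro order_trans[OF sum_abs sum_bounded_above])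
  qed simp
  have int: "integrable M (\<lambda>y. iexp (t * f y))" if [measurable]: "f \<in> borel_measurable M" for f :: "_ \<Rightarrow> real"
    by (intro integrable_bounded[of _ 1]) auto
  have intd: "integrable M (\<lambda>y. \<bar>t\<bar> * \<bar>S y - S' y\<bar>)"
    using dbd by (intro integrable_mult_right integrable_abs integrable_bounded) auto
  have "(CLINT y|M. iexp (t * S y)) - (CLINT y|M. iexp (t * S' y)) = (CLINT y|M. iexp (t * S y) - iexp (t * S' y))"
    using int by simp
  then have "cmod ((CLINT y|M. iexp (t * S y)) - (CLINT y|M. iexp (t * S' y)))
      \<le> (\<integral>y. cmod (iexp (t * S y) - iexp (t * S' y)) \<partial>M)"
    by (simp only: integral_norm_bound)
  also have "\<dots> \<le> (\<integral>y. \<bar>t\<bar> * \<bar>S y - S' y\<bar> \<partial>M)"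
  proof (rule integral_mono')
    show "cmod (iexp (t * S y) - iexp (t * S' y)) \<le> \<bar>t\<bar> * \<bar>S y - S' y\<bar>" for y
      using norm_iexp_diff_le[of "t * S y" "t * S' y"] by (simp add: abs_mult flip: right_diff_distrib)
  qed (use intd in auto)
  also have "\<dots> \<le> \<bar>t\<bar> * sqrt (\<integral>y. (S y - S' y)\<^sup>2 \<partial>M)"
    using expectation_abs_le_sqrt[OF _ dbd] by (simp add: mult_left_mono)
  also have "\<dots> \<le> \<bar>t\<bar> * sqrt (4 * K * total_gap k)"
    using remainder_second_moment[OF fin c2, of k] unfolding diff
    by (intro mult_left_mono real_sqrt_le_mono) auto
  finally show "norm ((CLINT y|M. iexp (t * (real (card (\<Gamma> n)) powr (- 1 / 2) * (\<Sum>i\<in>\<Gamma> n. V (shift_op i y)))))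
      - (CLINT y|M. iexp (t * (real (card (\<Gamma> n)) powr (- 1 / 2) * (\<Sum>i\<in>\<Gamma> n. Z k (shift_op i y))))))
      \<le> \<bar>t\<bar> * sqrt (4 * K * total_gap k)"
    by (simp only: S_def S'_def c_def)
qed

end

end

section \<open>Finitary factors\<close>

lemma topspace_prodiscrete [simp]: "topspace prodiscrete = UNIV"
  by (simp add: prodiscrete_def)

lemma sets_borel_sigma: "sets (borel_sigma T) = sigma_sets (topspace T) {U. openin T U}"
  unfolding borel_sigma_def by (rule sets_measure_of) (auto dest: openin_subset)

lemma space_borel_sigma: "space (borel_sigma T) = topspace T"
  unfolding borel_sigma_def by (rule space_measure_of) (auto dest: openin_subset)

lemma borel_measurable_continuous_map:
  assumes "continuous_map T euclideanreal f"
  shows "f \<in> borel_measurable (borel_sigma T)"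
proof (rule borel_measurableI)
  fix S :: "real set" assume "open S"
  then have "openin T {x \<in> topspace T. f x \<in> S}"
    by (intro openin_continuous_map_preimage[OF assms] open_openin[THEN iffD1])
  moreover have "f -` S \<inter> space (borel_sigma T) = {x \<in> topspace T. f x \<in> S}"
    by (auto simp: space_borel_sigma)
  ultimately show "f -` S \<inter> space (borel_sigma T) \<in> sets (borel_sigma T)"
    by (auto simp: sets_borel_sigma)
qed

text \<open>The alphabet is finite, so the space of all configurations is compact by Tychonoff, and
  hence so is its closed subset \<open>X\<close>.\<close>

lemma continuous_map_bounded:
  fixes X :: "('i \<Rightarrow> 'a::finite) set"
  assumes "closedin prodiscrete X" "continuous_map (subtopology prodiscrete X) euclideanreal v"
  shows "\<exists>K. \<forall>x\<in>X. \<bar>v x\<bar> \<le> K"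
proof -
  have "compact_space (prodiscrete :: ('i \<Rightarrow> 'a) topology)"
    by (simp add: prodiscrete_def compact_space_product_topology compact_space_discrete_topology)
  then have "compactin prodiscrete X"
    using assms(1) by (rule closedin_compact_space)
  then have "compactin (subtopology prodiscrete X) X"
    by (simp add: compactin_subtopology)
  then have "compact (v ` X)"
    using image_compactin[OF _ assms(2)] by (simp add: compactin_euclidean_iff)
  then show ?thesis
    by (auto dest!: compact_imp_bounded simp: bounded_iff)
qed

lemma continuous_map_shift:
  assumes "\<And>x. x \<in> X \<Longrightarrow> shift_op i x \<in> X"
  shows "continuous_map (subtopology prodiscrete X) (subtopology prodiscrete X) (shift_op i)"
  unfolding continuous_map_in_subtopology
proof
  show "continuous_map (subtopology prodiscrete X) prodiscrete (shift_op i)"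
    unfolding prodiscrete_def shift_op_def
    by (auto simp: continuous_map_componentwise_UNIV intro!: continuous_map_from_subtopology continuous_map_product_projection)
qed (use assms in auto)

text \<open>Scaling by the standard deviation, which is positive, reduces to the standard normal
  law.\<close>

lemma char_centred_normal:
  assumes "var > 0"
  shows "real_distribution (centred_normal var)"
    and "char (centred_normal var) t = complex_of_real (exp (- var * t\<^sup>2 / 2))"
proof -
  define \<sigma> where "\<sigma> = sqrt var"
  have \<sigma>: "\<sigma> > 0" "\<sigma>\<^sup>2 = var" using assms by (auto simp: \<sigma>_def)
  let ?N = "centred_normal var"
  have N: "?N = density lborel (normal_density 0 \<sigma>)" by (simp add: centred_normal_def \<sigma>_def)
  interpret N: prob_space ?N unfolding N by (rule prob_space_normal_density[OF \<sigma>(1)])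
  have [measurable_cong]: "sets ?N = sets borel" by (simp add: N)
  show "real_distribution ?N"
    by unfold_locales (simp_all add: N)
  have "distributed ?N lborel (\<lambda>x. x) (normal_density 0 \<sigma>)"
    unfolding distributed_def by (simp add: N distr_id2)
  then have "distributed ?N lborel (\<lambda>x. (x - 0) / \<sigma>) std_normal_density"
    by (simp only: N.normal_standard_normal_convert[OF \<sigma>(1)])
  then have std: "distr ?N lborel (\<lambda>x. x / \<sigma>) = std_normal_distribution"
    unfolding distributed_def by simp
  have "char ?N t = (CLINT x|?N. iexp (t * \<sigma> * (x / \<sigma>)))"
    using \<sigma> by (simp add: char_def)
  also have "\<dots> = (CLINT x|distr ?N lborel (\<lambda>x. x / \<sigma>). iexp (t * \<sigma> * x))"
    by (subst integral_distr) auto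
  also have "\<dots> = char std_normal_distribution (t * \<sigma>)"
    unfolding std by (simp add: char_def)
  also have "\<dots> = complex_of_real (exp (- var * t\<^sup>2 / 2))"
    unfolding char_std_normal_distribution \<sigma>(2)[symmetric] by (simp add: power_mult_distrib mult.commute)
  finally show "char ?N t = complex_of_real (exp (- var * t\<^sup>2 / 2))" .
qed

section \<open>Oscillations and regularity\<close>

context
  fixes X :: "(int ^ 'd \<Rightarrow> 'a) set" and v :: "(int ^ 'd \<Rightarrow> 'a) \<Rightarrow> real" and K :: real
  assumes bd: "\<And>x. x \<in> X \<Longrightarrow> \<bar>v x\<bar> \<le> K" and X: "X \<noteq> {}"
begin

text \<open>Boundedness is what lets the real \<open>Sup\<close> act as an upper bound.\<close>

lemma oscillation_bdd: "bdd_above {\<bar>v x - v x'\<bar> | x x'. x \<in> X \<and> x' \<in> X \<and> agree_on (box_set k) x x'}"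
proof (rule bdd_aboveI)
  fix r assume "r \<in> {\<bar>v x - v x'\<bar> | x x'. x \<in> X \<and> x' \<in> X \<and> agree_on (box_set k) x x'}"
  then obtain x x' where "r = \<bar>v x - v x'\<bar>" "x \<in> X" "x' \<in> X" by auto
  then show "r \<le> 2 * K" using bd[of x] bd[of x'] by linarith
qed

lemma oscillation_upper:
  "x \<in> X \<Longrightarrow> x' \<in> X \<Longrightarrow> agree_on (box_set k) x x' \<Longrightarrow> \<bar>v x - v x'\<bar> \<le> oscillation X v k"
  unfolding oscillation_def by (rule cSup_upper[OF _ oscillation_bdd]) auto

lemma decseq_oscillation: "decseq (oscillation X v)"
  unfolding decseq_def
proof (intro allI impI)
  fix k l :: nat assume "k \<le> l"
  then have sub: "box_set k \<subseteq> (box_set l :: (int ^ 'd) set)" by (rule box_set_mono)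
  obtain x where "x \<in> X" using X by auto
  then have "{\<bar>v x - v x'\<bar> | x x'. x \<in> X \<and> x' \<in> X \<and> agree_on (box_set l) x x'} \<noteq> {}"
    by (auto simp: agree_on_def)
  moreover have "agree_on (box_set k) x x'" if "agree_on (box_set l) x x'" for x x' :: "int ^ 'd \<Rightarrow> 'a"
    using that sub by (auto simp: agree_on_def)
  ultimately show "oscillation X v l \<le> oscillation X v k"
    unfolding oscillation_def by (intro cSup_subset_mono oscillation_bdd) blast+
qed

lemma oscillation_nonneg: "oscillation X v k \<ge> 0"
proof -
  obtain x where "x \<in> X" using X by auto
  then show ?thesis using oscillation_upper[of x x k] by (simp add: agree_on_def)
qed

text \<open>Since \<open>p \<ge> d - 1\<close>, the weight \<open>real (Suc k) ^ (d - 1)\<close> is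
  at most \<open>real (Suc k) powr p\<close>.\<close>

lemma summable_oscillation:
  assumes p: "p_regular X p v" and "p \<ge> real d - 1" "d > 0"
  shows "summable (\<lambda>k. real (Suc k) ^ (d - 1) * oscillation X v k)"
proof (subst summable_Suc_iff[symmetric], rule summable_comparison_test')
  show "summable (\<lambda>k. 2 ^ (d - 1) * (real (Suc k) powr p * oscillation X v (Suc k)))"
    using p unfolding p_regular_def by (rule summable_mult)
  fix k :: nat
  \<comment> \<open>Regularity weights the oscillation at \<open>Suc k\<close> by a power of
    \<open>Suc k\<close>, while the shifted series has \<open>Suc (Suc k)\<close>; the doubling
    costs \<open>2 ^ (d - 1)\<close>.\<close>
  have "real (Suc (Suc k)) ^ (d - 1) \<le> (2 * real (Suc k)) ^ (d - 1)" by (intro power_mono) auto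
  also have "\<dots> \<le> 2 ^ (d - 1) * real (Suc k) powr p"
  proof -
    have "real (Suc k) ^ (d - 1) = real (Suc k) powr real (d - 1)"
      by (simp add: powr_realpow del: of_nat_Suc)
    also have "\<dots> \<le> real (Suc k) powr p"
      using assms(2,3) by (intro powr_mono) (auto simp: of_nat_diff)
    finally show ?thesis unfolding power_mult_distrib by (intro mult_left_mono) auto
  qed
  finally show "norm (real (Suc (Suc k)) ^ (d - 1) * oscillation X v (Suc k))
      \<le> 2 ^ (d - 1) * (real (Suc k) powr p * oscillation X v (Suc k))"
    using oscillation_nonneg[of "Suc k"] by (simp add: mult_right_mono flip: mult.assoc)
qed

end

text \<open>The exponents add up to \<open>2 * d - 1 - s\<close>, which is below -1 because
  \<open>s > 2 * d\<close>.\<close>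

lemma summable_powr_tail:
  assumes "s > 2 * real d" "d > 0"
  shows "summable (\<lambda>k. real (Suc k) ^ (d - 1) * real (Suc k) powr (real d - s))"
proof -
  have "summable (\<lambda>k. real (Suc k) powr (2 * real d - 1 - s))"
    using assms by (subst summable_Suc_iff) (simp add: summable_real_powr_iff)
  also have "(\<lambda>k. real (Suc k) powr (2 * real d - 1 - s)) = (\<lambda>k. real (Suc k) ^ (d - 1) * real (Suc k) powr (real d - s))"
  proof
    fix k
    have "real (Suc k) powr (2 * real d - 1 - s) = real (Suc k) powr (real (d - 1) + (real d - s))"
      using assms by (intro arg_cong[of _ _ "\<lambda>x. real (Suc k) powr x"]) (simp add: of_nat_diff)
    then show "real (Suc k) powr (2 * real d - 1 - s) = real (Suc k) ^ (d - 1) * real (Suc k) powr (real d - s)"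
      by (simp add: powr_add powr_realpow del: of_nat_Suc)
  qed
  finally show ?thesis .
qed

section \<open>Transfer from the factor to the iid field, and the approximation rate\<close>

locale finitary_factor_field =
  fixes X :: "(int ^ 'd \<Rightarrow> 'a::finite) set"
    and \<mu> :: "(int ^ 'd \<Rightarrow> 'a) measure"
    and P :: "'l measure"
    and Y :: "(int ^ 'd \<Rightarrow> 'l) set"
    and \<pi> :: "(int ^ 'd \<Rightarrow> 'l) \<Rightarrow> (int ^ 'd \<Rightarrow> 'a)"
    and R :: "(int ^ 'd \<Rightarrow> 'l) \<Rightarrow> nat"
    and v :: "(int ^ 'd \<Rightarrow> 'a) \<Rightarrow> real"
    and K :: real
    and M :: "(int ^ 'd \<Rightarrow> 'l) measure"
  assumes subshift: "subshift X"
    and invariant: "invariant_prob X \<mu>"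
    and factor: "finitary_factor X \<mu> P Y \<pi> R"
    and cont: "continuous_map (subtopology prodiscrete X) euclideanreal v"
    and v_bd: "\<And>x. x \<in> X \<Longrightarrow> \<bar>v x\<bar> \<le> K"
    and M_def: "M = iid_measure P"
begin

sublocale iid_field P M
proof (rule iid_field.intro)
  show "prob_space P" using factor unfolding finitary_factor_def standard_borel_prob_def by blast
qed (rule M_def)

sublocale mu: prob_space \<mu>
  using invariant by (simp add: invariant_prob_def)

lemma X_nonempty: "X \<noteq> {}"
  using mu.not_empty invariant by (simp add: invariant_prob_def)

lemma shift_X: "x \<in> X \<Longrightarrow> shift_op i x \<in> X"
  using subshift unfolding subshift_def by blast

lemma shift_Y: "shift_op i y \<in> Y \<longleftrightarrow> y \<in> Y"
proof -
  have "\<And>i. shift_op i ` Y = Y" using factor by (simp add: finitary_factor_def)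
  then have *: "y \<in> Y \<Longrightarrow> shift_op i y \<in> Y" for i y by blast
  show ?thesis using *[of y i] *[of "shift_op i y" "- i"] by (auto simp: shift_op_shift_op shift_op_0)
qed

text \<open>\<open>emeasure\<close> is 0 on nonmeasurable sets by convention, so measure 1 forces
  measurability.\<close>

lemma Y_sets [measurable]: "Y \<in> sets M"
proof (rule ccontr)
  assume "Y \<notin> sets M"
  then have "emeasure M Y = 0" by (rule emeasure_notin_sets)
  then show False using factor by (simp add: finitary_factor_def M_def)
qed

lemma AE_Y: "AE y in M. y \<in> Y"
  using factor by (intro AE_prob_1) (simp add: finitary_factor_def M_def[symmetric] measure_def)

lemma \<pi>_X: "y \<in> Y \<Longrightarrow> \<pi> y \<in> X"
proof -
  assume y: "y \<in> Y"
  have "Y \<subseteq> space M" by (rule sets.sets_into_space[OF Y_sets])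
  with y have "y \<in> space (restrict_space M Y)" by (auto simp: space_restrict_space)
  moreover have "\<pi> \<in> measurable (restrict_space M Y) (borel_sigma (subtopology prodiscrete X))"
    using factor by (simp add: finitary_factor_def M_def)
  ultimately show "\<pi> y \<in> X" by (auto dest!: measurable_space simp: space_borel_sigma)
qed

lemma \<pi>_measurable: "\<pi> \<in> measurable (restrict_space M Y) \<mu>"
proof -
  have "\<pi> \<in> measurable (restrict_space M Y) (borel_sigma (subtopology prodiscrete X))"
    using factor by (simp add: finitary_factor_def M_def)
  moreover have "sets \<mu> = sets (borel_sigma (subtopology prodiscrete X))"
    using invariant by (simp add: invariant_prob_def)
  ultimately show ?thesis by (simp cong: measurable_cong_sets)
qed

lemma \<pi>_shift: "y \<in> Y \<Longrightarrow> shift_op i (\<pi> y) = \<pi> (shift_op i y)"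
  using factor by (simp add: finitary_factor_def)

text \<open>By equivariance, coordinate \<open>j\<close> of the image of \<open>y\<close> is
  coordinate 0 of the image of \<open>y\<close> shifted by \<open>j\<close>. Its coding window is a
  box of radius at most \<open>k\<close> around \<open>j\<close>, which lies in
  \<open>box_set (2 * k)\<close>.\<close>

lemma \<pi>_coordinate:
  assumes "y \<in> Y" "y' \<in> Y" "agree_on (box_set (2 * k)) y y'" "j \<in> box_set k" "R (shift_op j y) \<le> k"
  shows "\<pi> y j = \<pi> y' j"
proof -
  have "agree_on (box_set (R (shift_op j y))) (shift_op j y) (shift_op j y')"
    unfolding agree_on_def
  proof
    fix i :: "int ^ 'd" assume "i \<in> box_set (R (shift_op j y))"
    then have "i \<in> box_set k" using box_set_mono[OF assms(5)] by auto
    with assms(4) have "j + i \<in> box_set (k + k)" by (rule box_set_add)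
    then show "shift_op j y i = shift_op j y' i"
      using assms(3) by (simp add: agree_on_def shift_op_def mult_2)
  qed
  then have "\<pi> (shift_op j y) 0 = \<pi> (shift_op j y') 0"
    using factor assms(1,2) shift_Y unfolding finitary_factor_def by blast
  then show ?thesis
    using assms(1,2) by (simp add: \<pi>_shift[symmetric]) (simp add: shift_op_def)
qed

lemma measurable_v_shift: "(\<lambda>x. v (shift_op i x)) \<in> borel_measurable \<mu>"
proof -
  have "continuous_map (subtopology prodiscrete X) euclideanreal (v \<circ> shift_op i)"
    by (rule continuous_map_compose[OF continuous_map_shift cont]) (rule shift_X)
  then have "v \<circ> shift_op i \<in> borel_measurable (borel_sigma (subtopology prodiscrete X))"
    by (rule borel_measurable_continuous_map)
  moreover have "sets \<mu> = sets (borel_sigma (subtopology prodiscrete X))"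
    using invariant by (simp add: invariant_prob_def)
  ultimately show ?thesis by (simp add: comp_def cong: measurable_cong_sets)
qed

lemma measurable_v: "v \<in> borel_measurable \<mu>"
  using measurable_v_shift[of 0] by (simp add: shift_op_0)

text \<open>The value 0 off the conull set \<open>Y\<close> makes this bounded and measurable on the
  whole iid space; \<open>R'\<close> extends the coding radius in the same way.\<close>

definition V :: "(int ^ 'd \<Rightarrow> 'l) \<Rightarrow> real" where
  "V y = (if y \<in> Y then v (\<pi> y) else 0)"

definition R' :: "(int ^ 'd \<Rightarrow> 'l) \<Rightarrow> nat" where
  "R' y = (if y \<in> Y then R y else 0)"

lemma V_measurable [measurable]: "V \<in> borel_measurable M"
  unfolding V_def[abs_def]
  using measurable_comp[OF \<pi>_measurable measurable_v]
  by (subst measurable_restrict_space_iff[symmetric]) (auto simp: comp_def)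

lemma R'_measurable [measurable]: "R' \<in> measurable M (count_space UNIV)"
  unfolding R'_def[abs_def] using factor
  by (subst measurable_restrict_space_iff[symmetric]) (auto simp: finitary_factor_def M_def[symmetric])

lemma K_ge_0: "K \<ge> 0"
  using X_nonempty v_bd by (meson abs_ge_zero ex_in_conv order_trans)

lemma V_bd: "\<bar>V y\<bar> \<le> K"
  using K_ge_0 v_bd[OF \<pi>_X] by (simp add: V_def)

lemma V_shift: "y \<in> Y \<Longrightarrow> V (shift_op i y) = v (shift_op i (\<pi> y))"
  by (simp add: V_def shift_Y \<pi>_shift)

text \<open>\<open>\<mu>\<close> is the image under \<open>\<pi>\<close> of the iid measure on
  \<open>Y\<close>, and \<open>Y\<close> has full measure, so agreement on \<open>Y\<close> suffices
  for equality in law.\<close>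

lemma distr_transfer:
  assumes f: "f \<in> measurable \<mu> N" and g: "g \<in> measurable M N" and eq: "\<And>y. y \<in> Y \<Longrightarrow> g y = f (\<pi> y)"
  shows "distr \<mu> N f = distr M N g"
proof (rule measure_eqI)
  fix A assume "A \<in> sets (distr \<mu> N f)"
  then have A [measurable]: "A \<in> sets N" by simp
  note [measurable] = g
  have sub: "Y \<subseteq> space M" by (rule sets.sets_into_space[OF Y_sets])
  have "distr \<mu> N f = distr (distr (restrict_space M Y) \<mu> \<pi>) N f"
    using factor by (simp add: finitary_factor_def M_def[symmetric])
  also have "\<dots> = distr (restrict_space M Y) N (f \<circ> \<pi>)"
    by (rule distr_distr[OF f \<pi>_measurable])
  finally have "emeasure (distr \<mu> N f) A = emeasure (distr (restrict_space M Y) N (f \<circ> \<pi>)) A"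
    by simp
  also have "\<dots> = emeasure (restrict_space M Y) ((f \<circ> \<pi>) -` A \<inter> space (restrict_space M Y))"
    by (rule emeasure_distr[OF measurable_comp[OF \<pi>_measurable f] A])
  also have "(f \<circ> \<pi>) -` A \<inter> space (restrict_space M Y) = g -` A \<inter> Y"
    using sub eq by (auto simp: space_restrict_space)
  also have "emeasure (restrict_space M Y) (g -` A \<inter> Y) = emeasure M (g -` A \<inter> Y)"
    using sub by (intro emeasure_restrict_space) auto
  also have "\<dots> = emeasure M (g -` A \<inter> space M)"
  proof (rule emeasure_eq_AE)
    show "AE y in M. (y \<in> g -` A \<inter> Y) = (y \<in> g -` A \<inter> space M)"
      using AE_Y by eventually_elim (use sub in auto)
    show "g -` A \<inter> space M \<in> sets M" by measurable
    then have "g -` A \<inter> space M \<inter> Y \<in> sets M" using Y_sets by (rule sets.Int)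
    also have "g -` A \<inter> space M \<inter> Y = g -` A \<inter> Y" using sub by auto
    finally show "g -` A \<inter> Y \<in> sets M" .
  qed
  also have "\<dots> = emeasure (distr M N g) A"
    by (simp add: emeasure_distr)
  finally show "emeasure (distr \<mu> N f) A = emeasure (distr M N g) A" .
qed simp

lemma integral_transfer:
  fixes f g :: "_ \<Rightarrow> real"
  assumes "f \<in> borel_measurable \<mu>" "g \<in> borel_measurable M" "\<And>y. y \<in> Y \<Longrightarrow> g y = f (\<pi> y)"
  shows "(\<integral>x. f x \<partial>\<mu>) = (\<integral>y. g y \<partial>M)"
  using integral_distr[OF assms(1), of "\<lambda>x. x"] integral_distr[OF assms(2), of "\<lambda>x. x"]
  by (simp add: distr_transfer[OF assms])

lemma integral_V: "(\<integral>y. V y \<partial>M) = (\<integral>x. v x \<partial>\<mu>)"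
  by (rule integral_transfer[symmetric, OF measurable_v V_measurable]) (simp add: V_def)

lemma autocov_V: "autocov V i = correlation \<mu> v i"
  unfolding autocov_def correlation_def
proof (rule integral_transfer[symmetric])
  show "(\<lambda>x. v x * v (shift_op i x)) \<in> borel_measurable \<mu>"
    by (intro borel_measurable_times measurable_v measurable_v_shift)
  show "V y * V (shift_op i y) = v (\<pi> y) * v (shift_op i (\<pi> y))" if "y \<in> Y" for y
    using that by (simp add: V_shift) (simp add: V_def)
qed measurable

text \<open>If the coding radius is at most \<open>k\<close> at all shifts by
  \<open>box_set k\<close>, the images of \<open>y\<close> and of its resampling agree on
  \<open>box_set k\<close>, and the oscillation bounds the difference. Otherwise the trivial bound
  \<open>2 * K\<close> is charged to some shift; stationarity gives all shifts the same
  probability.\<close>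

lemma V_glue_bound:
  "(\<integral>y. \<bar>V y - avg (box_set (2 * k)) V y\<bar> \<partial>M)
    \<le> oscillation X v k + 2 * K * (2 * real k + 1) ^ CARD('d) * prob {y \<in> space M. R' y > k}"
proof -
  define bad where "bad j y = (indicator {y \<in> space M. R' y > k} (shift_op j y) :: real)" for j y
  \<comment> \<open>The majorant reads only the first sample, so its integral over the pair is an
    integral over \<open>M\<close>.\<close>
  define h where "h y = oscillation X v k + 2 * K * (\<Sum>j\<in>box_set k. bad j y)" for y
  have bad [measurable]: "bad j \<in> borel_measurable M" for j
    unfolding bad_def by measurable
  have h [measurable]: "h \<in> borel_measurable M"
    unfolding h_def by measurable
  have bad_int: "integrable M (bad j)" for j
    by (intro integrable_bounded[of _ 1]) (auto simp: bad_def indicator_def)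
  have h_int: "integrable M h"
    unfolding h_def using bad_int by (intro Bochner_Integration.integrable_add integrable_mult_right Bochner_Integration.integrable_sum) auto
  have hfst: "integrable (M \<Otimes>\<^sub>M M) (\<lambda>x. h (fst x))" "(\<integral>x. h (fst x) \<partial>(M \<Otimes>\<^sub>M M)) = (\<integral>y. h y \<partial>M)"
    using integrable_distr_eq[of fst "M \<Otimes>\<^sub>M M" M h] integral_distr[of fst "M \<Otimes>\<^sub>M M" M h] h_int
    by (simp_all add: distr_fst_M)
  have AE1: "AE x in M \<Otimes>\<^sub>M M. fst x \<in> Y \<and> fst x \<in> space M"
  proof -
    have "AE x in distr (M \<Otimes>\<^sub>M M) M fst. x \<in> Y \<and> x \<in> space M"
      unfolding distr_fst_M using AE_Y AE_space by eventually_elim simp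
    then show ?thesis by (rule AE_distrD[OF measurable_fst])
  qed
  \<comment> \<open>The resampled point again has law \<open>M\<close>, so it too lies in
    \<open>Y\<close> almost surely.\<close>
  have AE2: "AE x in M \<Otimes>\<^sub>M M. (case x of (y, z) \<Rightarrow> glue (box_set (2 * k)) y z) \<in> Y"
    by (rule AE_distrD[OF measurable_glue_M]) (subst distr_glue_M, rule AE_Y)
  have "(\<integral>y. \<bar>V y - avg (box_set (2 * k)) V y\<bar> \<partial>M)
      \<le> (\<integral>(y, z). \<bar>V y - V (glue (box_set (2 * k)) y z)\<bar> \<partial>(M \<Otimes>\<^sub>M M))"
    by (rule integral_diff_avg_le[OF V_measurable V_bd])
  also have "\<dots> \<le> (\<integral>x. h (fst x) \<partial>(M \<Otimes>\<^sub>M M))"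
  proof (rule integral_mono_AE')
    show "AE x in M \<Otimes>\<^sub>M M. (case x of (y, z) \<Rightarrow> \<bar>V y - V (glue (box_set (2 * k)) y z)\<bar>) \<le> h (fst x)"
      using AE1 AE2
    proof eventually_elim
      case (elim x)
      obtain y z where x: "x = (y, z)" by fastforce
      let ?y = "glue (box_set (2 * k)) y z"
      have y: "y \<in> Y" "y \<in> space M" "?y \<in> Y" using elim by (auto simp: x)
      have agree: "agree_on (box_set (2 * k)) y ?y" by (auto simp: agree_on_def glue_def)
      have bad_nn: "bad j y \<ge> 0" for j by (simp add: bad_def)
      have osc_nn: "oscillation X v k \<ge> 0" by (rule oscillation_nonneg[OF v_bd X_nonempty])
      show ?case
      proof (cases "\<forall>j\<in>box_set k. R (shift_op j y) \<le> k")
        case True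
        then have "agree_on (box_set k) (\<pi> y) (\<pi> ?y)"
          using \<pi>_coordinate[OF y(1,3) agree] by (auto simp: agree_on_def)
        then have "\<bar>v (\<pi> y) - v (\<pi> ?y)\<bar> \<le> oscillation X v k"
          by (intro oscillation_upper[where v = v and K = K] v_bd X_nonempty \<pi>_X y)
        moreover have "0 \<le> 2 * K * (\<Sum>j\<in>box_set k. bad j y)"
          using K_ge_0 bad_nn by (intro mult_nonneg_nonneg sum_nonneg) auto
        ultimately show ?thesis using y by (simp add: x h_def V_def)
      next
        case False
        then obtain j where j: "j \<in> box_set k" "R (shift_op j y) > k" by auto
        then have "bad j y = 1"
          using y measurable_space[OF measurable_shift y(2), of j] by (simp add: bad_def R'_def shift_Y)
        then have "1 \<le> (\<Sum>j\<in>box_set k. bad j y)"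
          using member_le_sum[OF j(1) _ finite_box_set, of "\<lambda>j. bad j y"] bad_nn by simp
        then have "2 * K * 1 \<le> 2 * K * (\<Sum>j\<in>box_set k. bad j y)"
          using K_ge_0 by (intro mult_left_mono) auto
        moreover have "\<bar>V y - V ?y\<bar> \<le> 2 * K" using V_bd[of y] V_bd[of ?y] by linarith
        ultimately show ?thesis using osc_nn by (simp add: x h_def)
      qed
    qed
    then show "AE x in M \<Otimes>\<^sub>M M. 0 \<le> h (fst x)"
      by eventually_elim (auto split: prod.splits intro: order_trans[OF abs_ge_zero])
  qed (use hfst in auto)
  also have "\<dots> = oscillation X v k + 2 * K * (\<Sum>j\<in>box_set k. \<integral>y. bad j y \<partial>M)"
    unfolding hfst(2) unfolding h_def using bad_int by (simp add: prob_space)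
  also have "(\<Sum>j\<in>box_set k. \<integral>y. bad j y \<partial>M) = (\<Sum>j\<in>(box_set k :: (int ^ 'd) set). prob {y \<in> space M. R' y > k})"
  proof (rule sum.cong[OF refl])
    fix j :: "int ^ 'd"
    show "(\<integral>y. bad j y \<partial>M) = prob {y \<in> space M. R' y > k}"
      unfolding bad_def by (subst integral_shift) auto
  qed
  finally show ?thesis by (simp add: card_box_set mult.assoc add.commute)
qed

text \<open>Markov's inequality for the \<open>s\<close>-th moment; for integers, exceeding
  \<open>k\<close> means being at least \<open>Suc k\<close>.\<close>

lemma coding_radius_tail:
  assumes s: "s > 0" and fin: "(\<integral>\<^sup>+ y. ennreal (real (R y) powr s) \<partial>restrict_space (iid_measure P) Y) < \<infinity>"
  shows "\<exists>I\<ge>0. \<forall>k. prob {y \<in> space M. R' y > k} \<le> I * real (Suc k) powr (- s)"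
proof -
  have "(\<integral>\<^sup>+ y. ennreal (real (R' y) powr s) \<partial>M) = (\<integral>\<^sup>+ y. ennreal (real (R y) powr s) * indicator Y y \<partial>M)"
    using s by (intro nn_integral_cong) (auto simp: R'_def indicator_def)
  also have "\<dots> = (\<integral>\<^sup>+ y. ennreal (real (R y) powr s) \<partial>restrict_space M Y)"
    by (rule nn_integral_restrict_space[symmetric]) simp
  finally have int: "integrable M (\<lambda>y. real (R' y) powr s)"
    using fin[folded M_def] by (intro integrableI_bounded) auto
  define I where "I = (\<integral>y. real (R' y) powr s \<partial>M)"
  have "prob {y \<in> space M. R' y > k} \<le> I * real (Suc k) powr (- s)" for k
  proof -
    have "(\<integral>y. real (Suc k) powr s * indicator {y \<in> space M. R' y > k} y \<partial>M) \<le> I"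
      unfolding I_def
    proof (rule integral_mono[OF _ int])
      show "real (Suc k) powr s * indicator {y \<in> space M. R' y > k} y \<le> real (R' y) powr s" for y
        using s by (auto simp: indicator_def intro!: powr_mono2)
      show "integrable M (\<lambda>y. real (Suc k) powr s * indicator {y \<in> space M. R' y > k} y)"
        by (intro integrable_mult_right integrable_bounded[of _ 1]) (auto simp: indicator_def)
    qed
    then have "real (Suc k) powr s * prob {y \<in> space M. R' y > k} \<le> I" by simp
    then show ?thesis by (simp add: powr_minus field_simps)
  qed
  moreover have "I \<ge> 0" unfolding I_def by simp
  ultimately show ?thesis by blast
qed

lemma approximation_rate:
  assumes p: "p_regular X p v" "p \<ge> real CARD('d) - 1" and s: "s > 2 * real CARD('d)"
    and fin: "(\<integral>\<^sup>+ y. ennreal (real (R y) powr s) \<partial>restrict_space (iid_measure P) Y) < \<infinity>"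
  obtains \<gamma> where "\<And>k. (\<integral>y. \<bar>V y - avg (box_set (2 * k)) V y\<bar> \<partial>M) \<le> \<gamma> k"
    "decseq \<gamma>" "summable (\<lambda>k. real (Suc k) ^ (CARD('d) - 1) * \<gamma> k)"
proof -
  have d: "real CARD('d) > 0" by simp
  have "s > 0" using s d by linarith
  from coding_radius_tail[OF this fin] obtain I where I: "I \<ge> 0"
    "\<And>k. prob {y \<in> space M. R' y > k} \<le> I * real (Suc k) powr (- s)" by blast
  \<comment> \<open>Collects \<open>(2 * k + 1) ^ d \<le> 2 ^ d * (k + 1) ^ d\<close> from the box
    size, the bound \<open>2 * K\<close> and the moment constant; the power
    \<open>(k + 1) ^ d\<close> joins the tail \<open>(k + 1) powr (- s)\<close>.\<close>
  define C where "C = 2 * K * 2 ^ CARD('d) * I"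
  \<comment> \<open>Both terms decrease in \<open>k\<close>, as the comparison of approximation
    levels requires.\<close>
  define \<gamma> where "\<gamma> k = oscillation X v k + C * real (Suc k) powr (real CARD('d) - s)" for k
  have C: "C \<ge> 0" using K_ge_0 I by (simp add: C_def)
  show thesis
  proof
    fix k
    have "2 * K * (2 * real k + 1) ^ CARD('d) * prob {y \<in> space M. R' y > k}
        \<le> 2 * K * (2 * real (Suc k)) ^ CARD('d) * (I * real (Suc k) powr (- s))"
      using I(2)[of k] K_ge_0 by (intro mult_mono mult_left_mono power_mono) auto
    also have "\<dots> = C * (real (Suc k) powr real CARD('d) * real (Suc k) powr (- s))"
      unfolding power_mult_distrib C_def by (simp add: powr_realpow del: of_nat_Suc)
    also have "\<dots> = C * real (Suc k) powr (real CARD('d) - s)"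
      by (simp flip: powr_add)
    finally show "(\<integral>y. \<bar>V y - avg (box_set (2 * k)) V y\<bar> \<partial>M) \<le> \<gamma> k"
      unfolding \<gamma>_def by (rule order_trans[OF V_glue_bound add_left_mono])
  next
    show "decseq \<gamma>"
      unfolding decseq_def \<gamma>_def
    proof (intro allI impI add_mono mult_left_mono C)
      fix m n :: nat assume "m \<le> n"
      then show "oscillation X v n \<le> oscillation X v m"
        using decseq_oscillation[OF v_bd X_nonempty] by (auto simp: decseq_def)
      show "real (Suc n) powr (real CARD('d) - s) \<le> real (Suc m) powr (real CARD('d) - s)"
        using \<open>m \<le> n\<close> s d by (intro powr_mono2') auto
    qed
    have "summable (\<lambda>k. real (Suc k) ^ (CARD('d) - 1) * oscillation X v k
        + C * (real (Suc k) ^ (CARD('d) - 1) * real (Suc k) powr (real CARD('d) - s)))"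
      using s by (intro summable_add summable_mult summable_powr_tail summable_oscillation[OF v_bd X_nonempty p]) auto
    then show "summable (\<lambda>k. real (Suc k) ^ (CARD('d) - 1) * \<gamma> k)"
      by (simp add: \<gamma>_def distrib_left mult.left_commute)
  qed
qed

end

section \<open>The central limit theorem for finitary factors\<close>

theorem theorem2p3:
  fixes X :: "(int ^ 'd \<Rightarrow> 'a::finite) set"
    and \<mu> :: "(int ^ 'd \<Rightarrow> 'a) measure"
    and P :: "'l measure"
    and Y :: "(int ^ 'd \<Rightarrow> 'l) set"
    and \<pi> :: "(int ^ 'd \<Rightarrow> 'l) \<Rightarrow> (int ^ 'd \<Rightarrow> 'a)"
    and R :: "(int ^ 'd \<Rightarrow> 'l) \<Rightarrow> nat"
    and \<Gamma> :: "nat \<Rightarrow> (int ^ 'd) set"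
    and v :: "(int ^ 'd \<Rightarrow> 'a) \<Rightarrow> real"
    and p s :: real
  assumes "subshift X"
    and "invariant_prob X \<mu>"
    and "finitary_factor X \<mu> P Y \<pi> R"
    and "folner \<Gamma>"
    and "continuous_map (subtopology prodiscrete X) euclideanreal v"
    and "(LINT x|\<mu>. v x) = 0"
    and "p \<ge> real CARD('d) - 1"
    and "s > 2 * real CARD('d) + (real CARD('d))\<^sup>2 / (p + 1)"
    and "p_regular X p v"
    and "(\<integral>\<^sup>+ y. ennreal (real (R y) powr s) \<partial>restrict_space (iid_measure P) Y) < \<infinity>"
  shows "correlation \<mu> v summable_on UNIV \<and>
         asymptotic_variance \<mu> v \<ge> 0 \<and>
         (asymptotic_variance \<mu> v > 0 \<longrightarrow>
           weak_conv_m
             (\<lambda>n. distr \<mu> borel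
                (\<lambda>x. real (card (\<Gamma> n)) powr (- 1 / 2) * (\<Sum>i\<in>\<Gamma> n. v (shift_op i x))))
             (centred_normal (asymptotic_variance \<mu> v)))"
proof -
  obtain K where K: "\<And>x. x \<in> X \<Longrightarrow> \<bar>v x\<bar> \<le> K"
    using continuous_map_bounded[of X v] assms(1,5) by (auto simp: subshift_def)
  interpret F: finitary_factor_field X \<mu> P Y \<pi> R v K "iid_measure P"
    using assms K by unfold_locales auto
  \<comment> \<open>Since \<open>p + 1 \<ge> d > 0\<close>, the quotient is nonnegative, and
    \<open>s > 2 * d\<close> follows.\<close>
  have "(real CARD('d))\<^sup>2 / (p + 1) \<ge> 0" using assms(7) by (intro divide_nonneg_nonneg) (auto intro: order_trans[OF _ add_right_mono[OF assms(7)]])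
  then have s: "s > 2 * real CARD('d)" using assms(8) by linarith
  from F.approximation_rate[OF assms(9,7) s assms(10)] obtain \<gamma> where \<gamma>:
    "\<And>k. (\<integral>y. \<bar>F.V y - F.avg (box_set (2 * k)) F.V y\<bar> \<partial>iid_measure P) \<le> \<gamma> k"
    "decseq \<gamma>" "summable (\<lambda>k. real (Suc k) ^ (CARD('d) - 1) * \<gamma> k)" by blast
  have mean: "(\<integral>y. F.V y \<partial>iid_measure P) = 0" using assms(6) by (simp add: F.integral_V)
  note A = F.V_measurable F.V_bd mean \<gamma> assms(4)
  have cov: "F.autocov F.V = correlation \<mu> v" by (rule ext) (rule F.autocov_V)
  have sm: "correlation \<mu> v summable_on UNIV"
    using F.summable_autocov[OF A] by (simp add: cov)
  have nonneg: "asymptotic_variance \<mu> v \<ge> 0"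
    using F.infsum_autocov_nonneg[OF A] by (simp add: cov asymptotic_variance_def)
  \<comment> \<open>By Levy's continuity theorem it suffices to treat characteristic functions,
    which are evaluated on the iid space after the normalised sums are transferred there. Positive
    variance makes the limit a genuine normal density.\<close>
  have "weak_conv_m
      (\<lambda>n. distr \<mu> borel (\<lambda>x. real (card (\<Gamma> n)) powr (- 1 / 2) * (\<Sum>i\<in>\<Gamma> n. v (shift_op i x))))
      (centred_normal (asymptotic_variance \<mu> v))" if pos: "asymptotic_variance \<mu> v > 0"
  proof (rule levy_continuity)
    fix n
    show "real_distribution (distr \<mu> borel (\<lambda>x. real (card (\<Gamma> n)) powr (- 1 / 2) * (\<Sum>i\<in>\<Gamma> n. v (shift_op i x))))"
      by (intro F.mu.real_distribution_distr borel_measurable_times borel_measurable_const borel_measurable_sum F.measurable_v_shift)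
  next
    show "real_distribution (centred_normal (asymptotic_variance \<mu> v))"
      by (rule char_centred_normal(1)[OF pos])
  next
    fix t
    define S where "S n y = real (card (\<Gamma> n)) powr (- 1 / 2) * (\<Sum>i\<in>\<Gamma> n. F.V (shift_op i y))" for n y
    have S [measurable]: "S n \<in> borel_measurable (iid_measure P)" for n unfolding S_def by measurable
    have "distr \<mu> borel (\<lambda>x. real (card (\<Gamma> n)) powr (- 1 / 2) * (\<Sum>i\<in>\<Gamma> n. v (shift_op i x)))
        = distr (iid_measure P) borel (S n)" for n
    proof (rule F.distr_transfer[OF _ S])
      show "(\<lambda>x. real (card (\<Gamma> n)) powr (- 1 / 2) * (\<Sum>i\<in>\<Gamma> n. v (shift_op i x))) \<in> borel_measurable \<mu>"
        by (intro borel_measurable_times borel_measurable_const borel_measurable_sum F.measurable_v_shift)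
    qed (simp add: S_def F.V_shift)
    then have "char (distr \<mu> borel (\<lambda>x. real (card (\<Gamma> n)) powr (- 1 / 2) * (\<Sum>i\<in>\<Gamma> n. v (shift_op i x)))) t
        = (CLINT y|iid_measure P. iexp (t * S n y))" for n
      unfolding char_def by (simp only:) (rule integral_distr; measurable)
    then show "(\<lambda>n. char (distr \<mu> borel (\<lambda>x. real (card (\<Gamma> n)) powr (- 1 / 2) * (\<Sum>i\<in>\<Gamma> n. v (shift_op i x)))) t)
        \<longlonglongrightarrow> char (centred_normal (asymptotic_variance \<mu> v)) t"
      using F.char_tendsto[OF A, of t]
      unfolding S_def char_centred_normal(2)[OF pos] unfolding cov asymptotic_variance_def by (simp only:)
  qed
  then show ?thesis using sm nonneg by blast
qed

end
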